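(* Let $n$ be a positive integer and let $f(x_1,\ldots,x_n)\in\mathbb{Q}[x_1,\ldots,x_n]$ be a symmetric polynomial of degree $r$. Put $T=\max\{[(r+n-2)/2],[(n-1)/2]\}$. Then there exist polynomials $c_{f,l}(x),c^\star_{f,l}(x)\in\mathbb{Q}[x]$ ($0\leq l\leq T$), depending only on $l$ and $f$ (in particular not on $k$), with $\deg c_{f,l}(x)\leq r+n-2l-1$ and $\deg c^\star_{f,l}(x)\leq r+n-2l-1$, such that for every integer $k\geq n$, $$\sum_{\substack{k_1+\cdots+k_n=k\\ k_j\geq 1}}f(k_1,\ldots,k_n)\,t(2k_1,2k_2,\ldots,2k_n)=\sum_{l=0}^{\min\{T,k\}}c_{f,l}(k)\,\zeta(2l)\,t(2k-2l)$$ and $$\sum_{\substack{k_1+\cdots+k_n=k\\ k_j\geq 1}}f(k_1,\ldots,k_n)\,t^\star(2k_1,2k_2,\ldots,2k_n)=\sum_{l=0}^{\min\{T,k\}}c^\star_{f,l}(k)\,\zeta(2l)\,t(2k-2l),$$ where the sums on the left run over all $n$-tuples $(k_1,\ldots,k_n)$ of positive integers with sum $k$.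
   Context: For positive integers $k_1,\ldots,k_n$ with $k_1>1$, the multiple $t$-value and the multiple $t$-star value are $$t(k_1,\ldots,k_n)=\sum_{\substack{m_1>m_2>\cdots>m_n>0\\ m_i\ \text{odd}}}\frac{1}{m_1^{k_1}\cdots m_n^{k_n}},\qquad t^\star(k_1,\ldots,k_n)=\sum_{\substack{m_1\geq m_2\geq\cdots\geq m_n\geq 1\\ m_i\ \text{odd}}}\frac{1}{m_1^{k_1}\cdots m_n^{k_n}}.$$ In particular $t(s)=\sum_{m\ge1,\ m\text{ odd}}m^{-s}$ for $s\geq 2$. $\zeta$ is the Riemann zeta function. Conventions: $\zeta(0)=-1/2$ and $t(0)=0$. For a real number $\alpha$, $[\alpha]$ denotes the greatest integer not exceeding $\alpha$. The zero polynomial is regarded as having degree $-\infty$ in degree bounds for the coefficient polynomials. *)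

theory Defs
  imports
    "HOL-Analysis.Analysis"
    "HOL-Combinatorics.Permutations"
    "HOL-Library.Poly_Mapping"
    "HOL-Computational_Algebra.Polynomial"
begin

text \<open>
  Multivariate polynomials are finitely supported maps from monomials (finitely supported
  exponent vectors) to coefficients; the ring structure is the one of \<^theory>\<open>HOL-Library.Poly_Mapping\<close>.
  The variables \<open>x\<^sub>1, \<dots>, x\<^sub>n\<close> are numbered \<open>0, \<dots>, n - 1\<close>.
\<close>

type_synonym 'a mpoly = "(nat \<Rightarrow>\<^sub>0 nat) \<Rightarrow>\<^sub>0 'a"

definition mpoly_vars :: "'a::zero mpoly \<Rightarrow> nat set" where
  "mpoly_vars f = (\<Union>m \<in> Poly_Mapping.keys f. Poly_Mapping.keys m)"

text \<open>The zero polynomial gets degree \<open>0\<close>, as for \<^const>\<open>Polynomial.degree\<close>.\<close>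

definition mpoly_degree :: "'a::zero mpoly \<Rightarrow> nat" where
  "mpoly_degree f =
     Max (insert 0 ((\<lambda>m. \<Sum>i \<in> Poly_Mapping.keys m. Poly_Mapping.lookup m i) ` Poly_Mapping.keys f))"

definition mpoly_eval :: "(nat \<Rightarrow> 'a) \<Rightarrow> 'a::comm_semiring_1 mpoly \<Rightarrow> 'a" where
  "mpoly_eval x f =
     (\<Sum>m \<in> Poly_Mapping.keys f. Poly_Mapping.lookup f m *
        (\<Prod>i \<in> Poly_Mapping.keys m. x i ^ Poly_Mapping.lookup m i))"

text \<open>
  For a permutation \<open>\<pi>\<close>, the exponent of variable \<open>i\<close> in \<open>Poly_Mapping.map_key \<pi> m\<close> is the
  exponent of variable \<open>\<pi> i\<close> in \<open>m\<close>.
\<close>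

definition symmetric_mpoly :: "nat \<Rightarrow> 'a::zero mpoly \<Rightarrow> bool" where
  "symmetric_mpoly n f \<longleftrightarrow>
     (\<forall>\<pi>. \<pi> permutes {..<n} \<longrightarrow>
        (\<forall>m. Poly_Mapping.lookup f (Poly_Mapping.map_key \<pi> m) = Poly_Mapping.lookup f m))"

text \<open>
  An index \<open>(k\<^sub>1, \<dots>, k\<^sub>n)\<close> is a list. The sums are meaningful for positive entries with
  \<open>k\<^sub>1 > 1\<close>; all summands are nonnegative, so the order of summation is immaterial.
\<close>

definition mtv :: "nat list \<Rightarrow> real" where
  "mtv ks =
     (\<Sum>\<^sub>\<infinity> ms \<in> {ms :: nat list. length ms = length ks \<and> sorted_wrt (>) ms \<and> (\<forall>m \<in> set ms. m > 0 \<and> odd m)}.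
        1 / (\<Prod>i<length ks. real (ms ! i) ^ (ks ! i)))"

definition mtv_star :: "nat list \<Rightarrow> real" where
  "mtv_star ks =
     (\<Sum>\<^sub>\<infinity> ms \<in> {ms :: nat list. length ms = length ks \<and> sorted_wrt (\<ge>) ms \<and> (\<forall>m \<in> set ms. m \<ge> 1 \<and> odd m)}.
        1 / (\<Prod>i<length ks. real (ms ! i) ^ (ks ! i)))"

text \<open>The single \<open>t\<close>-value, with the convention \<open>t(0) = 0\<close>.\<close>

definition tval :: "nat \<Rightarrow> real" where
  "tval s = (if s = 0 then 0 else mtv [s])"

text \<open>
  The Riemann zeta function at natural numbers other than its pole \<open>s = 1\<close> (where the value is
  meaningless), with \<open>\<zeta>(0) = - 1 / 2\<close>.
\<close>

definition zeta :: "nat \<Rightarrow> real" where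
  "zeta s = (if s = 0 then - 1 / 2 else suminf (\<lambda>m. 1 / real (Suc m) ^ s))"

definition compositions :: "nat \<Rightarrow> nat \<Rightarrow> nat list set" where
  "compositions n k = {ks. length ks = n \<and> (\<forall>j \<in> set ks. j \<ge> 1) \<and> sum_list ks = k}"

text \<open>Degree bound in which the zero polynomial has degree \<open>- \<infinity>\<close>.\<close>

definition degree_le :: "'a::zero poly \<Rightarrow> int \<Rightarrow> bool" where
  "degree_le p d \<longleftrightarrow> p = 0 \<or> int (degree p) \<le> d"

end

theory Submission
  imports Defs "HOL-Combinatorics.Multiset_Permutations"
begin

text \<open>
  Write \<open>t\<^sub>k = t(2k)\<close> with \<open>t\<^sub>0 = 0\<close>, \<open>p = t(2)\<close>, \<open>P = p X\<close>, \<open>G = \<Sum> t\<^sub>k X\<^sup>k\<close> and \<open>\<theta> = X d/dX\<close>.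

  \<^emph>\<open>Symmetrization.\<close> Since \<open>f\<close> is symmetric, the contribution of a tuple \<open>(m\<^sub>1, \<dots>, m\<^sub>n)\<close> of odd numbers,
  summed over all exponents \<open>k\<^sub>1, \<dots>, k\<^sub>n\<close>, depends only on its multiset. So \<open>n!\<close> times a sum over ordered
  tuples is a sum over all tuples, weighted by the indicator of distinct entries for \<open>t\<close>, and by the
  product of the factorials of the multiplicities for \<open>t\<^sup>\<star>\<close>. With \<open>\<epsilon> = -1\<close> and \<open>\<epsilon> = 1\<close> respectively, both
  weights satisfy
  \<open>w(x, xs) = w(xs) (1 + \<epsilon> (multiplicity of x in xs))\<close>, and one argument serves for both
  (\<open>sum_weakly_decreasing\<close>, \<open>sum_strictly_decreasing\<close>).

  \<^emph>\<open>Reduction to products of single series.\<close> For a monomial \<open>f\<close>, the generating function in \<open>k\<close> of the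
  sum over all tuples is a weighted sum of products of \<open>\<Sum>\<^sub>k k\<^sup>a (X/m\<^sup>2)\<^sup>k\<close>, which is a polynomial of degree
  \<open>a + 1\<close> without constant term in \<open>X/(m\<^sup>2 - X)\<close>. The recursion for the weights (\<open>tuple_sum_Cons\<close>) splits
  off one entry or multiplies its factor into that of another entry; the total degree \<open>r + n\<close> is kept.
  Hence the generating function is a rational combination of products of at most \<open>n\<close> single series
  \<open>\<Sum>\<^sub>m u(X/m\<^sup>2)\<close>, and each of these is a rational combination of the \<open>\<theta>\<^sup>j G\<close> (\<open>tuple_sum_limit\<close>).

  \<^emph>\<open>Linearization.\<close> The convolution identity \<open>\<Sum> t\<^sub>j t\<^bsub>k-j\<^esub> = (k - 1/2) t\<^sub>k\<close> says that \<open>\<theta>G = G/2 + H\<close> where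
  \<open>H = G\<^sup>2 + P/2\<close>. One computes \<open>\<theta>H = (2G + 1)H\<close>, so the ideal generated by \<open>H\<close> is stable under \<open>\<theta>\<close>, and
  modulo this ideal \<open>\<theta>\<close> multiplies \<open>G\<close> by \<open>1/2\<close> and \<open>G\<^sup>2\<close> equals \<open>-P/2\<close>. So a product of \<open>i\<close> single series
  is a rational multiple of \<open>G\<^sup>i\<close>, that is of \<open>P\<^sup>l\<close> or \<open>P\<^sup>l G\<close> with \<open>l = i div 2\<close>, plus an element of the ideal.
  The formula for \<open>\<theta>(G\<^sup>m H)\<close> expresses \<open>G\<^sup>m H\<close> through the \<open>P\<^sup>l \<theta>\<^sup>j H\<close>, which are linear in \<open>G\<close>
  (\<open>tG_power_tH_t_form\<close>). The coefficient of \<open>X\<^sup>k\<close> in \<open>P\<^sup>l \<theta>\<^sup>j G\<close> is \<open>p\<^sup>l (k - l)\<^sup>j t\<^bsub>k-l\<^esub>\<close>, and \<open>p\<^sup>l\<close> is a rational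
  multiple of \<open>\<zeta>(2l)\<close> (\<open>t_even_power_eq_rat_zeta\<close>).

  \<^emph>\<open>The bounds.\<close> Give \<open>G\<close> and \<open>\<theta>\<close> weight \<open>1\<close> and \<open>P\<close> weight \<open>2\<close>. All terms have weight at most \<open>r + n\<close>, which
  is the bound for the degrees. In the ideal, \<open>2l + 2 \<le> r + n\<close>, because \<open>H\<close> has weight \<open>2\<close>; the term from
  \<open>G\<^sup>i\<close> has \<open>2l + 1 = i \<le> n\<close> for odd \<open>i\<close>. This gives the two entries of the maximum that defines \<open>T\<close>.
  For even \<open>i\<close>, \<open>G\<^sup>i\<close> contributes a constant multiple of \<open>X\<close> to the power \<open>i/2 < n\<close>, which is not seen by
  the coefficients with \<open>k \<ge> n\<close>.
\<close>

unbundle no vec_syntax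
unbundle fps_syntax

section \<open>The values t(2k): convolution identity and relation to zeta\<close>

text \<open>
  This is \<open>t(2k)\<close>; see \<open>tval_eq_t_even\<close>. The value \<open>0\<close> at \<open>k = 0\<close> is the convention \<open>t(0) = 0\<close> and makes the
  generating function start in degree one.
\<close>

definition t_even :: "nat \<Rightarrow> real" where
  "t_even k = (if k = 0 then 0 else suminf (\<lambda>b. 1 / real (2 * b + 1) ^ (2 * k)))"

lemma t_even_0 [simp]: "t_even 0 = 0"
  by (simp add: t_even_def)

lemma summable_odd_powers:
  assumes "k \<ge> 1"
  shows "summable (\<lambda>b. 1 / real (2 * b + 1) ^ (2 * k))"
proof (rule summable_comparison_test')
  show "summable (\<lambda>b. inverse (of_nat (Suc b) ^ 2 :: real))"
    using summable_Suc_iff[of "\<lambda>n. inverse (of_nat n ^ 2 :: real)"] inverse_power_summable[of 2, where ?'a = real]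
    by simp
  fix b :: nat
  have "real (Suc b) ^ 2 \<le> real (2 * b + 1) ^ 2"
    by (rule power_mono) auto
  also have "\<dots> \<le> real (2 * b + 1) ^ (2 * k)"
    by (rule power_increasing) (use assms in auto)
  finally have "real (Suc b) ^ 2 \<le> real (2 * b + 1) ^ (2 * k)" .
  hence "1 / real (2 * b + 1) ^ (2 * k) \<le> 1 / real (Suc b) ^ 2"
    by (intro divide_left_mono mult_pos_pos) auto
  thus "norm (1 / real (2 * b + 1) ^ (2 * k)) \<le> inverse (of_nat (Suc b) ^ 2)"
    by (simp add: inverse_eq_divide)
qed

lemma t_even_sums: "k \<ge> 1 \<Longrightarrow> (\<lambda>b. 1 / real (2 * b + 1) ^ (2 * k)) sums t_even k"
  using summable_odd_powers[of k] by (simp add: t_even_def summable_sums)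

lemma t_even_LIMSEQ: "k \<ge> 1 \<Longrightarrow> (\<lambda>N. \<Sum>b<N. 1 / real (2 * b + 1) ^ (2 * k)) \<longlonglongrightarrow> t_even k"
  using t_even_sums[of k] by (simp add: sums_def)

lemma sum_le_t_even: "k \<ge> 1 \<Longrightarrow> (\<Sum>b<N. 1 / real (2 * b + 1) ^ (2 * k)) \<le> t_even k"
  using sum_le_suminf[OF summable_odd_powers[of k], of "{..<N}"] by (simp add: t_even_def)

lemma t_even_pos: "k \<ge> 1 \<Longrightarrow> t_even k > 0"
  using sum_le_t_even[of k 1] by simp

lemma harm_eq_sum: "(\<Sum>b<N. 1 / (real b + 1)) = harm N"
  by (induction N) (auto simp: harm_Suc field_simps harm_def[of 0])

lemma harm_diff_le: "harm (m + d) - harm m \<le> real d / (real m + 1)"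
proof (induction d)
  case (Suc d)
  have "inverse (real (Suc (m + d))) \<le> 1 / (real m + 1)"
    by (simp add: field_simps)
  with Suc show ?case by (simp add: harm_Suc add_divide_distrib)
qed simp

lemma harm_over_n_LIMSEQ: "(\<lambda>N. 2 * harm N / (real N + 1)) \<longlonglongrightarrow> (0 :: real)"
proof -
  have "(\<lambda>N. (harm N - ln (real N)) * (2 / (real N + 1)) + 2 * ln (real N) / (real N + 1))
          \<longlonglongrightarrow> euler_mascheroni * 0 + (0 :: real)"
  proof (intro tendsto_add tendsto_mult euler_mascheroni_LIMSEQ)
    show "(\<lambda>N. 2 / (real N + 1)) \<longlonglongrightarrow> 0"
      using tendsto_mult_right_zero[OF LIMSEQ_inverse_real_of_nat, of 2]
      by (simp add: field_simps)
    show "(\<lambda>N. 2 * ln (real N) / (real N + 1)) \<longlonglongrightarrow> 0"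
    proof -
      have "(\<lambda>N. 2 * (ln (real N) / real N) * (real N / real (Suc N))) \<longlonglongrightarrow> 2 * 0 * 1"
        by (intro tendsto_mult tendsto_const lim_ln_over_n LIMSEQ_n_over_Suc_n)
      also have "(\<lambda>N. 2 * (ln (real N) / real N) * (real N / real (Suc N))) = (\<lambda>N. 2 * ln (real N) / (real N + 1))"
      proof
        fix N show "2 * (ln (real N) / real N) * (real N / real (Suc N)) = 2 * ln (real N) / (real N + 1)"
          by (cases N) (simp_all add: add_ac)
      qed
      finally show ?thesis by simp
    qed
  qed
  also have "(\<lambda>N. (harm N - ln (real N)) * (2 / (real N + 1)) + 2 * ln (real N) / (real N + 1))
      = (\<lambda>N. 2 * harm N / (real N + 1))"
    by (auto simp: fun_eq_iff left_diff_distrib add_divide_distrib diff_divide_distrib mult.commute)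
  finally show ?thesis by simp
qed

text \<open>
  The sum includes \<open>c = b\<close>, whose term is \<open>1 / 0 = 0\<close>; the terms below and above \<open>b\<close> give the two
  harmonic numbers.
\<close>

lemma sum_inverse_diff:
  assumes "b < N"
  shows "(\<Sum>c<N. 1 / (real c - real b)) = harm (N - 1 - b) - harm b"
proof -
  have "(\<Sum>c<b + 1 + M. 1 / (real c - real b)) = harm M - harm b" for M
  proof (induction M)
    case 0
    have "(\<Sum>c<b. 1 / (real c - real b)) = (\<Sum>c<b. 1 / (real (b - Suc c) - real b))"
      by (rule sum.nat_diff_reindex[symmetric])
    also have "\<dots> = (\<Sum>c<b. - (1 / (real c + 1)))"
      by (intro sum.cong refl) (auto simp: of_nat_diff field_simps)
    also have "\<dots> = - harm b"
      by (simp only: sum_negf harm_eq_sum)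
    finally show ?case by (simp add: harm_def[of 0])
  qed (simp add: harm_Suc inverse_eq_divide add_ac)
  from this[of "N - 1 - b"] assms show ?thesis by simp
qed

lemma sum_inverse_add: "(\<Sum>c<N. 1 / (real c + real b + 1)) = harm (N + b) - harm b"
  by (induction N) (auto simp: harm_Suc inverse_eq_divide add_ac)

text \<open>
  The kernel \<open>1 / (y - x)\<close> for odd squares \<open>x\<close> and \<open>y\<close>. Division by zero makes it vanish on the diagonal, so
  sums over \<open>c \<noteq> b\<close> can be written as sums over all \<open>c\<close>.
\<close>

definition odd_diff :: "nat \<Rightarrow> nat \<Rightarrow> real" where
  "odd_diff b c = 1 / ((2 * real c + 1)^2 - (2 * real b + 1)^2)"

lemma odd_diff_swap: "odd_diff c b = - odd_diff b c"
  unfolding odd_diff_def by (simp flip: divide_minus_right)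

text \<open>
  Partial fractions turn the sum into differences of harmonic numbers. The limit for large \<open>N\<close> is
  \<open>1 / (4 (2b+1)\<^sup>2)\<close>; it comes from the missing diagonal term. The finite form is needed because the limit is
  later taken together with the outer sum over \<open>b < N\<close>.
\<close>

lemma sum_odd_diff:
  assumes "b < N"
  shows "(\<Sum>c<N. odd_diff b c) =
    1 / (4 * (2 * real b + 1)) * (1 / (2 * real b + 1) - (harm (N + b) - harm (N - 1 - b)))"
proof -
  have "odd_diff b c = 1 / (4 * (2 * real b + 1)) *
     (1 / (real c - real b) - 1 / (real c + real b + 1) + (if c = b then 1 / (2 * real b + 1) else 0))" for c
  proof (cases "c = b")
    case False
    have 1: "(2 * real c + 1)^2 - (2 * real b + 1)^2 = 4 * ((real c - real b) * (real c + real b + 1))"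
      by (simp add: power2_eq_square algebra_simps)
    have 2: "1 / (real c - real b) - 1 / (real c + real b + 1) =
       (2 * real b + 1) / ((real c - real b) * (real c + real b + 1))"
      using False by (simp add: field_simps)
    have "2 * real b + 1 \<noteq> 0" by linarith
    hence "1 / (4 * y) = 1 / (4 * (2 * real b + 1)) * ((2 * real b + 1) / y)" for y
      by (simp del: distrib_left_numeral)
    from this[of "(real c - real b) * (real c + real b + 1)"] False show ?thesis
      by (simp only: odd_diff_def 1 2 if_False add_0_right)
  qed (simp add: odd_diff_def)
  hence "(\<Sum>c<N. odd_diff b c) = 1 / (4 * (2 * real b + 1)) *
     ((\<Sum>c<N. 1 / (real c - real b)) - (\<Sum>c<N. 1 / (real c + real b + 1)) +
      (\<Sum>c<N. if c = b then 1 / (2 * real b + 1) else 0))"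
    by (simp only: sum.distrib sum_subtractf sum_distrib_left[symmetric])
  also have "(\<Sum>c<N. if c = b then 1 / (2 * real b + 1) else 0) = 1 / (2 * real b + 1)"
    using assms by (simp add: sum.delta')
  finally show ?thesis
    by (simp add: sum_inverse_diff[OF assms] sum_inverse_add)
qed

text \<open>
  A geometric sum, written so that for \<open>x = 1/m\<^sup>2\<close>, \<open>y = 1/m'\<^sup>2\<close> the last factor is \<open>1 / (m'\<^sup>2 - m\<^sup>2)\<close>.
\<close>

lemma sum_mixed_powers:
  fixes x y :: real
  assumes "x \<noteq> 0" "y \<noteq> 0" "x \<noteq> y" "k \<ge> 1"
  shows "(\<Sum>j=1..<k. x ^ j * y ^ (k - j)) = (x ^ (k-1) - y ^ (k-1)) * (1 / (1 / y - 1 / x))"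
proof -
  obtain l where l: "k = Suc l" using assms by (cases k) auto
  have "(\<Sum>j=1..<k. x ^ j * y ^ (k - j)) = x * y * (\<Sum>j<l. x ^ j * y ^ (l - Suc j))"
    unfolding l sum_distrib_left
    by (rule sum.reindex_bij_witness[of _ "Suc" "\<lambda>j. j - 1"])
       (auto simp: Suc_diff_Suc power_eq_if)
  also have "(x - y) * (\<Sum>j<l. x ^ j * y ^ (l - Suc j)) = x ^ l - y ^ l"
    using power_diff_sumr2[of x l y] by (simp add: mult.commute)
  hence "(\<Sum>j<l. x ^ j * y ^ (l - Suc j)) = (x ^ l - y ^ l) / (x - y)"
    using assms by (simp add: field_simps)
  finally show ?thesis using assms l by (simp add: field_simps)
qed

text \<open>
  The difference of harmonic numbers has \<open>2b + 1\<close> terms of size at most \<open>1 / (N - b)\<close>, so the summand is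
  at most \<open>1 / ((b + 1) (N - b))\<close>, and by partial fractions these sum up to \<open>2 harm N / (N + 1)\<close>.
\<close>

lemma convolution_remainder_LIMSEQ:
  assumes k: "k \<ge> 2"
  shows "(\<lambda>N. \<Sum>b<N. (1 / real (2 * b + 1) ^ 2) ^ (k - 1) * (1 / (2 * (2 * real b + 1))) *
     (harm (N + b) - harm (N - 1 - b))) \<longlonglongrightarrow> 0" (is "?R \<longlonglongrightarrow> 0")
proof (rule tendsto_sandwich[OF _ _ tendsto_const harm_over_n_LIMSEQ])
  show "\<forall>\<^sub>F N in sequentially. 0 \<le> ?R N"
    by (intro always_eventually allI sum_nonneg mult_nonneg_nonneg) (auto intro!: harm_mono)
  have "?R N \<le> 2 * harm N / (real N + 1)" for N
  proof -
    have "?R N \<le> (\<Sum>b<N. (1 / (real b + 1) + 1 / (real N - real b)) / (real N + 1))"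
    proof (rule sum_mono)
      fix b assume "b \<in> {..<N}"
      hence b: "b < N" by simp
      define m where "m = 2 * real b + 1"
      have m: "m \<ge> real b + 1" "m \<ge> 1" "m > 0" by (auto simp: m_def)
      have "harm (N - 1 - b + (2 * b + 1)) - harm (N - 1 - b) \<le> real (2 * b + 1) / (real (N - 1 - b) + 1)"
        by (rule harm_diff_le)
      also have "N - 1 - b + (2 * b + 1) = N + b" using b by simp
      also have "real (2 * b + 1) / (real (N - 1 - b) + 1) = m / (real N - real b)"
        using b by (simp add: m_def of_nat_diff)
      finally have h: "harm (N + b) - harm (N - 1 - b) \<le> m / (real N - real b)" .
      have "(1 / m ^ 2) ^ (k - 1) \<le> (1 / m ^ 2) ^ 1"
        by (rule power_decreasing) (use k m in \<open>auto simp: field_simps\<close>)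
      also have "\<dots> \<le> 1 / (real b + 1)"
      proof -
        have "real b + 1 \<le> m * 1" using m by simp
        also have "\<dots> \<le> m * m" using m by (intro mult_left_mono) auto
        finally show ?thesis by (simp add: power2_eq_square frac_le)
      qed
      finally have "(1 / m ^ 2) ^ (k - 1) * (1 / (2 * m)) * (harm (N + b) - harm (N - 1 - b))
         \<le> 1 / (real b + 1) * (1 / (2 * m)) * (m / (real N - real b))"
        using h m b by (intro mult_mono) (auto intro!: harm_mono)
      also have "\<dots> = 1 / 2 * (1 / ((real b + 1) * (real N - real b)))"
        using m by simp
      also have "\<dots> \<le> 1 * (1 / ((real b + 1) * (real N - real b)))"
        using b by (intro mult_right_mono) auto
      also have "\<dots> = (1 / (real b + 1) + 1 / (real N - real b)) / (real N + 1)"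
      proof -
        have "1 / x + 1 / y = (x + y) / (x * y)" if "x > 0" "y > 0" for x y :: real
          using that by (simp add: field_simps)
        from this[of "real b + 1" "real N - real b"] b
        have eq: "1 / (real b + 1) + 1 / (real N - real b) = (real N + 1) / ((real b + 1) * (real N - real b))"
          by (simp add: add_ac)
        have "1 / y = (real N + 1) / y / (real N + 1)" for y :: real by simp
        thus ?thesis unfolding eq mult_1 .
      qed
      finally show "(1 / real (2 * b + 1) ^ 2) ^ (k - 1) * (1 / (2 * (2 * real b + 1))) *
          (harm (N + b) - harm (N - 1 - b)) \<le> \<dots>" by (simp add: m_def add_ac)
    qed
    also have "\<dots> = (harm N + (\<Sum>b<N. 1 / (real N - real b))) / (real N + 1)"
      by (simp add: sum.distrib harm_eq_sum flip: sum_divide_distrib)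
    also have "(\<Sum>b<N. 1 / (real N - real b)) = (\<Sum>b<N. 1 / (real N - real (N - Suc b)))"
      by (rule sum.nat_diff_reindex[symmetric])
    also have "\<dots> = (\<Sum>b<N. 1 / (real b + 1))"
      by (intro sum.cong) (auto simp: of_nat_diff field_simps)
    also have "\<dots> = harm N" by (rule harm_eq_sum)
    finally show ?thesis by simp
  qed
  thus "\<forall>\<^sub>F N in sequentially. ?R N \<le> 2 * harm N / (real N + 1)" by simp
qed

text \<open>
  Expand the product of the truncated sums into a double sum over odd \<open>m\<close> and \<open>m'\<close>. The diagonal gives
  \<open>k - 1\<close> copies of \<open>t(2k)\<close>. Off the diagonal the sum over \<open>j\<close> is geometric and equals
  \<open>(m\<^bsup>2-2k\<^esup> - m'\<^bsup>2-2k\<^esup>) / (m'\<^sup>2 - m\<^sup>2)\<close>; by symmetry this is twice a sum whose inner part tends to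
  \<open>1/(4 m\<^sup>2)\<close> by \<open>sum_odd_diff\<close>, which gives another half of \<open>t(2k)\<close>.
\<close>

theorem t_even_convolution:
  assumes k: "k \<ge> 2"
  shows "(\<Sum>j=1..<k. t_even j * t_even (k - j)) = (real k - 1 / 2) * t_even k"
proof -
  define a where "a b = 1 / real (2 * b + 1) ^ 2" for b :: nat
  have a: "a b > 0" for b by (simp add: a_def)
  have a_inj: "a b \<noteq> a c" if "b \<noteq> c" for b c
    using that by (auto simp: a_def power2_eq_iff)
  have lim: "(\<lambda>N. \<Sum>b<N. a b ^ j) \<longlonglongrightarrow> t_even j" if "j \<ge> 1" for j
    using t_even_LIMSEQ[OF that] by (simp add: a_def power_mult power_divide)
  define R where "R N = (\<Sum>b<N. (1 / real (2 * b + 1) ^ 2) ^ (k - 1) * (1 / (2 * (2 * real b + 1))) *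
     (harm (N + b) - harm (N - 1 - b)))" for N
  have "(\<Sum>j=1..<k. (\<Sum>b<N. a b ^ j) * (\<Sum>b<N. a b ^ (k - j))) =
      (real k - 1 / 2) * (\<Sum>b<N. a b ^ k) - R N" for N
  proof -
    have "(\<Sum>j=1..<k. (\<Sum>b<N. a b ^ j) * (\<Sum>b<N. a b ^ (k - j))) =
       (\<Sum>j=1..<k. \<Sum>b<N. \<Sum>c<N. a b ^ j * a c ^ (k - j))"
      by (simp add: sum_product)
    also have "\<dots> = (\<Sum>b<N. \<Sum>j=1..<k. \<Sum>c<N. a b ^ j * a c ^ (k - j))"
      by (rule sum.swap)
    also have "\<dots> = (\<Sum>b<N. \<Sum>c<N. \<Sum>j=1..<k. a b ^ j * a c ^ (k - j))"
      by (intro sum.cong refl sum.swap)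
    also have "\<dots> = (\<Sum>b<N. \<Sum>c<N. (if c = b then (real k - 1) * a b ^ k else 0) +
        (a b ^ (k-1) * odd_diff b c + a c ^ (k-1) * odd_diff c b))"
    proof (intro sum.cong refl)
      fix b c
      show "(\<Sum>j=1..<k. a b ^ j * a c ^ (k - j)) = (if c = b then (real k - 1) * a b ^ k else 0) +
        (a b ^ (k-1) * odd_diff b c + a c ^ (k-1) * odd_diff c b)"
      proof (cases "c = b")
        case True
        have "(\<Sum>j=1..<k. a b ^ j * a b ^ (k - j)) = (\<Sum>j=1..<k. a b ^ k)"
          by (intro sum.cong refl) (auto simp flip: power_add)
        thus ?thesis using True k by (simp add: odd_diff_def of_nat_diff)
      next
        case False
        have "1 / (1 / a c - 1 / a b) = odd_diff b c"
          by (simp add: a_def odd_diff_def add_ac)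
        moreover have "(\<Sum>j=1..<k. a b ^ j * a c ^ (k - j)) =
            (a b ^ (k-1) - a c ^ (k-1)) * (1 / (1 / a c - 1 / a b))"
          by (rule sum_mixed_powers) (use False k a[of b] a[of c] a_inj[of c b] in auto)
        ultimately show ?thesis using False by (simp add: odd_diff_swap[of c b] algebra_simps)
      qed
    qed
    also have "\<dots> = (\<Sum>b<N. \<Sum>c<N. if c = b then (real k - 1) * a b ^ k else 0) +
       ((\<Sum>b<N. \<Sum>c<N. a b ^ (k-1) * odd_diff b c) + (\<Sum>b<N. \<Sum>c<N. a c ^ (k-1) * odd_diff c b))"
      by (simp add: sum.distrib)
    also have "(\<Sum>b<N. \<Sum>c<N. a c ^ (k-1) * odd_diff c b) = (\<Sum>b<N. \<Sum>c<N. a b ^ (k-1) * odd_diff b c)"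
      by (rule sum.swap)
    also have "(\<Sum>b<N. \<Sum>c<N. if c = b then (real k - 1) * a b ^ k else 0) = (real k - 1) * (\<Sum>b<N. a b ^ k)"
      by (simp add: sum_distrib_left)
    also have "(\<Sum>b<N. \<Sum>c<N. a b ^ (k-1) * odd_diff b c) =
        (\<Sum>b<N. a b ^ k / 4 - a b ^ (k-1) * (1 / (4 * (2 * real b + 1))) * (harm (N + b) - harm (N - 1 - b)))"
    proof (intro sum.cong refl)
      fix b assume "b \<in> {..<N}"
      hence b: "b < N" by simp
      have "a b ^ k = a b ^ (k-1) * a b" using k by (simp flip: power_Suc2)
      hence "a b ^ k = a b ^ (k-1) * (1 / (2 * real b + 1) ^ 2)" by (simp add: a_def add_ac)
      thus "(\<Sum>c<N. a b ^ (k-1) * odd_diff b c) = a b ^ k / 4 -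
           a b ^ (k-1) * (1 / (4 * (2 * real b + 1))) * (harm (N + b) - harm (N - 1 - b))"
        by (simp add: sum_odd_diff[OF b] power2_eq_square right_diff_distrib flip: sum_distrib_left)
    qed
    also have "\<dots> = (\<Sum>b<N. a b ^ k) / 4 - R N / 2"
    proof -
      have "R N / 2 = (\<Sum>b<N. a b ^ (k-1) * (1 / (4 * (2 * real b + 1))) * (harm (N + b) - harm (N - 1 - b)))"
        unfolding R_def sum_divide_distrib a_def
        by (intro sum.cong refl) (simp del: distrib_left_numeral)
      thus ?thesis by (simp only: sum_subtractf sum_divide_distrib[symmetric])
    qed
    finally show ?thesis by (simp add: algebra_simps)
  qed
  moreover have "(\<lambda>N. \<Sum>j=1..<k. (\<Sum>b<N. a b ^ j) * (\<Sum>b<N. a b ^ (k - j)))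
      \<longlonglongrightarrow> (\<Sum>j=1..<k. t_even j * t_even (k - j))"
    by (intro tendsto_sum tendsto_mult lim) auto
  moreover have "(\<lambda>N. (real k - 1 / 2) * (\<Sum>b<N. a b ^ k) - R N)
      \<longlonglongrightarrow> (real k - 1 / 2) * t_even k - 0"
    unfolding R_def using k by (intro tendsto_intros lim convolution_remainder_LIMSEQ) auto
  ultimately show ?thesis using LIMSEQ_unique by simp
qed

text \<open>
  The convolution identity is a recursion with positive rational coefficients; positivity is what keeps
  the factor from vanishing.
\<close>

theorem t_even_eq_rat_power: "\<exists>q :: rat. q \<noteq> 0 \<and> t_even (Suc l) = of_rat q * t_even 1 ^ Suc l"
proof -
  have "\<exists>q :: rat. q > 0 \<and> t_even k = of_rat q * t_even 1 ^ k" if "k \<ge> 1" for k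
    using that
  proof (induction k rule: less_induct)
    case (less k)
    show ?case
    proof (cases "k = 1")
      case True
      have "t_even 1 = of_rat 1 * t_even 1 ^ 1" by simp
      thus ?thesis unfolding True using zero_less_one by blast
    next
      case False
      hence k: "k \<ge> 2" using less.prems by simp
      have "\<forall>j\<in>{1..<k}. \<exists>q::rat. q > 0 \<and> t_even j = of_rat q * t_even 1 ^ j"
        using less.IH by (metis atLeastLessThan_iff)
      from bchoice[OF this] obtain q :: "nat \<Rightarrow> rat"
        where q: "\<And>j. j \<in> {1..<k} \<Longrightarrow> q j > 0 \<and> t_even j = of_rat (q j) * t_even 1 ^ j"
        by blast
      define s where "s = (\<Sum>j=1..<k. q j * q (k - j))"
      have "s > 0" unfolding s_def
        by (intro sum_pos mult_pos_pos) (use q k in \<open>auto\<close>)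
      have "(\<Sum>j=1..<k. t_even j * t_even (k - j)) = (\<Sum>j=1..<k. of_rat (q j * q (k - j)) * t_even 1 ^ k)"
      proof (intro sum.cong refl)
        fix j assume j: "j \<in> {1..<k}"
        hence "k - j \<in> {1..<k}" by auto
        with j have "t_even j * t_even (k - j) = (of_rat (q j) * t_even 1 ^ j) * (of_rat (q (k - j)) * t_even 1 ^ (k - j))"
          by (intro arg_cong2[of _ _ _ _ "(*)"] conjunct2[OF q])
        also have "\<dots> = of_rat (q j * q (k - j)) * (t_even 1 ^ (j + (k - j)))"
          by (simp only: of_rat_mult power_add mult_ac)
        finally show "t_even j * t_even (k - j) = of_rat (q j * q (k - j)) * t_even 1 ^ k" using j by simp
      qed
      also have "\<dots> = of_rat s * t_even 1 ^ k" by (simp add: s_def of_rat_sum sum_distrib_right)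
      finally have "(real k - 1 / 2) * t_even k = of_rat s * t_even 1 ^ k"
        using t_even_convolution[OF k] by simp
      moreover have "real k - 1/2 > 0" using k by simp
      moreover have "of_rat (s / (of_nat k - 1 / 2)) = of_rat s / (real k - 1/2)"
        by (simp add: of_rat_divide of_rat_diff)
      moreover have "x = s' / c * y" if "c * x = s' * y" "c > 0" for x y s' c :: real
        using that by (simp add: field_simps)
      ultimately have eq: "t_even k = of_rat (s / (of_nat k - 1 / 2)) * t_even 1 ^ k"
        by metis
      have "(of_nat k :: rat) \<ge> 2"
        using k by (metis of_nat_le_iff of_nat_numeral)
      hence "(of_nat k - 1 / 2 :: rat) > 0"
        by linarith
      hence "s / (of_nat k - 1 / 2) > 0" using \<open>s > 0\<close> by simp
      with eq show ?thesis by blast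
    qed
  qed
  from this[of "Suc l"] obtain q :: rat where "q > 0" "t_even (Suc l) = of_rat q * t_even 1 ^ Suc l"
    by auto
  thus ?thesis by (intro exI[of _ q]) simp
qed

text \<open>Split the integers into the odd and the even ones.\<close>

lemma zeta_even:
  assumes "l \<ge> 1"
  shows "zeta (2 * l) = 4 ^ l / (4 ^ l - 1) * t_even l"
proof -
  have sm: "summable (\<lambda>b. 1 / real (Suc b) ^ (2 * l))"
    using summable_Suc_iff[of "\<lambda>n. inverse (of_nat n ^ (2 * l) :: real)"]
      inverse_power_summable[of "2 * l", where ?'a = real] assms
    by (simp add: inverse_eq_divide)
  have "strict_mono (\<lambda>N::nat. 2 * N)" by (auto simp: strict_mono_def)
  have lim: "(\<lambda>N. \<Sum>b<N. 1 / real (Suc b) ^ (2 * l)) \<longlonglongrightarrow> zeta (2 * l)"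
    using summable_LIMSEQ[OF sm] assms by (simp add: zeta_def)
  have "(\<Sum>b<2 * N. 1 / real (Suc b) ^ (2 * l)) =
     (\<Sum>b<N. 1 / real (2 * b + 1) ^ (2 * l)) + (1 / 4 ^ l) * (\<Sum>b<N. 1 / real (Suc b) ^ (2 * l))" for N
  proof (induction N)
    case (Suc N)
    have "real (Suc (Suc (2 * N))) = 2 * real (Suc N)" by simp
    hence "1 / real (Suc (Suc (2 * N))) ^ (2 * l) = (1 / 4 ^ l) * (1 / real (Suc N) ^ (2 * l))"
      by (simp only: power_mult power_mult_distrib) simp
    thus ?case using Suc by (simp add: algebra_simps)
  qed simp
  moreover have "(\<lambda>N. \<Sum>b<2 * N. 1 / real (Suc b) ^ (2 * l)) \<longlonglongrightarrow> zeta (2 * l)"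
    using LIMSEQ_subseq_LIMSEQ[OF lim \<open>strict_mono _\<close>] by (simp add: o_def)
  moreover have "(\<lambda>N. (\<Sum>b<N. 1 / real (2 * b + 1) ^ (2 * l)) + (1 / 4 ^ l) * (\<Sum>b<N. 1 / real (Suc b) ^ (2 * l)))
     \<longlonglongrightarrow> t_even l + (1 / 4 ^ l) * zeta (2 * l)"
    by (intro tendsto_intros t_even_LIMSEQ lim assms)
  ultimately have "zeta (2 * l) = t_even l + (1 / 4 ^ l) * zeta (2 * l)"
    using LIMSEQ_unique by simp
  moreover have "(4::real) ^ l > 1" using assms by (intro one_less_power) auto
  ultimately show ?thesis by (simp add: field_simps)
qed

lemma t_even_power_eq_rat_zeta: "\<exists>q :: rat. t_even 1 ^ l = of_rat q * zeta (2 * l)"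
proof (cases l)
  case 0
  thus ?thesis by (intro exI[of _ "-2"]) (simp add: zeta_def of_rat_minus)
next
  case (Suc l')
  obtain q :: rat where q: "q \<noteq> 0" "t_even l = of_rat q * t_even 1 ^ l"
    using t_even_eq_rat_power Suc by blast
  have "(4::real) ^ l > 1" using Suc by (intro one_less_power) auto
  moreover have "of_rat ((4 ^ l - 1) / (4 ^ l * q)) = (4 ^ l - 1) / (4 ^ l * (of_rat q :: real))"
    by (simp add: of_rat_divide of_rat_diff of_rat_mult of_rat_power)
  moreover have "y = (x - 1) / (x * c) * (x / (x - 1) * (c * y))" if "x > 1" "c \<noteq> 0" for x c y :: real
    using that by (simp add: field_simps)
  ultimately have "t_even 1 ^ l = of_rat ((4 ^ l - 1) / (4 ^ l * q)) * (4 ^ l / (4 ^ l - 1) * t_even l)"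
    using q by simp
  thus ?thesis using zeta_even[of l] Suc by auto
qed

section \<open>The differential algebra generated by G\<close>

definition rat_fps :: "rat \<Rightarrow> real fps" where
  "rat_fps c = fps_const (of_rat c)"

lemma rat_fps_simps: "rat_fps 0 = 0" "rat_fps 1 = 1" "rat_fps (a + b) = rat_fps a + rat_fps b" "rat_fps (a * b) = rat_fps a * rat_fps b"
  "rat_fps (- a) = - rat_fps a" "rat_fps (a - b) = rat_fps a - rat_fps b" "rat_fps (of_nat n) = of_nat n"
  by (simp_all add: rat_fps_def of_rat_add of_rat_mult of_rat_minus of_rat_diff flip: fps_of_nat)

lemma rat_fps_nth [simp]: "(rat_fps c * F) $ k = of_rat c * F $ k"
  by (simp add: rat_fps_def)

lemma rat_fps_inverse: "c \<noteq> 0 \<Longrightarrow> rat_fps (1 / c) * (rat_fps c * F) = F"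
  by (simp add: rat_fps_simps(1,2) flip: mult.assoc rat_fps_simps(4))

inductive_set rat_span :: "real fps set \<Rightarrow> real fps set" for B where
  zero: "0 \<in> rat_span B"
| base: "b \<in> B \<Longrightarrow> b \<in> rat_span B"
| add: "F \<in> rat_span B \<Longrightarrow> F' \<in> rat_span B \<Longrightarrow> F + F' \<in> rat_span B"
| scale: "F \<in> rat_span B \<Longrightarrow> rat_fps c * F \<in> rat_span B"

lemma rat_span_diff: "F \<in> rat_span B \<Longrightarrow> F' \<in> rat_span B \<Longrightarrow> F - F' \<in> rat_span B"
  using rat_span.add[OF _ rat_span.scale[of F' B "-1"], of F] by (simp add: rat_fps_simps)

lemma rat_span_of_nat: "F \<in> rat_span B \<Longrightarrow> of_nat n * F \<in> rat_span B"
  using rat_span.scale[of F B "of_nat n"] by (simp add: rat_fps_simps)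

lemma rat_span_sum: "(\<And>i. i \<in> I \<Longrightarrow> F i \<in> rat_span B) \<Longrightarrow> (\<Sum>i\<in>I. F i) \<in> rat_span B"
  by (induction I rule: infinite_finite_induct) (auto intro: rat_span.intros)

lemma rat_span_linear:
  assumes "\<And>F F'. T (F + F') = T F + T F'" "\<And>c F. T (rat_fps c * F) = rat_fps c * T F"
    and "\<And>b. b \<in> B \<Longrightarrow> T b \<in> rat_span B'" and "F \<in> rat_span B"
  shows "T F \<in> rat_span B'"
  using assms(4)
proof induction
  case zero
  have "T 0 = 0" using assms(2)[of 0 0] by (simp add: rat_fps_simps)
  thus ?case by (simp add: rat_span.zero)
qed (simp_all add: assms(1-3) rat_span.add rat_span.scale)

lemma rat_span_mono: "B \<subseteq> rat_span B' \<Longrightarrow> F \<in> rat_span B \<Longrightarrow> F \<in> rat_span B'"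
  using rat_span_linear[of "\<lambda>F. F" B B' F] by blast

lemma rat_span_mult:
  assumes "\<And>b b'. b \<in> B \<Longrightarrow> b' \<in> B' \<Longrightarrow> b * b' \<in> rat_span B''"
    and "F \<in> rat_span B" "F' \<in> rat_span B'"
  shows "F * F' \<in> rat_span B''"
proof -
  have "b * F' \<in> rat_span B''" if "b \<in> B" for b
    by (rule rat_span_linear[where T = "\<lambda>F. b * F", OF _ _ _ assms(3)])
       (use that assms(1) in \<open>auto simp: distrib_left mult.left_commute\<close>)
  thus ?thesis
    by (intro rat_span_linear[where T = "\<lambda>F. F * F'", OF _ _ _ assms(2)]) (auto simp: algebra_simps)
qed

definition theta :: "real fps \<Rightarrow> real fps" where
  "theta F = fps_X * fps_deriv F"

lemma theta_nth [simp]: "theta F $ k = of_nat k * F $ k"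
  by (cases k) (simp_all add: theta_def)

lemma theta_add: "theta (F + F') = theta F + theta F'"
  by (simp add: fps_eq_iff algebra_simps)

lemma theta_scale: "theta (rat_fps c * F) = rat_fps c * theta F"
  by (simp add: fps_eq_iff)

lemma theta_mult: "theta (F * F') = theta F * F' + F * theta F'"
  by (simp add: theta_def algebra_simps)

lemma theta_power: "theta (F ^ m) = of_nat m * F ^ (m - 1) * theta F"
  by (simp add: theta_def fps_deriv_power' mult_ac)

definition tG :: "real fps" where "tG = Abs_fps t_even"

definition tP :: "real fps" where "tP = fps_const (t_even 1) * fps_X"

text \<open>
  Defined by the formula that is linear in \<open>tG\<close>; the quadratic expression for it is \<open>tH_eq\<close>.
\<close>

definition tH :: "real fps" where "tH = theta tG - rat_fps (1/2) * tG"

lemma tG_nth [simp]: "tG $ k = t_even k"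
  by (simp add: tG_def)

lemma tP_mult_nth: "(tP * F) $ k = (if k = 0 then 0 else t_even 1 * F $ (k - 1))"
  by (simp add: tP_def mult.assoc)

lemma rat_fps_half: "rat_fps (1/2) + rat_fps (1/2) = 1"
  by (simp flip: rat_fps_simps)

lemma theta_tG: "theta tG = tH + rat_fps (1/2) * tG"
  by (simp add: tH_def)

text \<open>
  The convolution identity in terms of generating functions. It fails in degree one, where the
  convolution is empty; the term with \<open>tP\<close> makes up for this.
\<close>

lemma tH_eq: "tH = tG * tG + rat_fps (1/2) * tP"
proof (rule fps_ext)
  fix k :: nat
  have half: "of_rat (1 / 2) = (1 / 2 :: real)" by (simp add: of_rat_divide)
  have tP: "tP $ k = (if k = 1 then t_even 1 else 0)" for k by (simp add: tP_def)
  have sq: "(tG * tG) $ k = (\<Sum>j=1..<k. t_even j * t_even (k - j))" for k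
  proof -
    have "(tG * tG) $ k = (\<Sum>j=0..k. t_even j * t_even (k - j))" by (simp add: fps_mult_nth)
    also have "\<dots> = (\<Sum>j=1..<k. t_even j * t_even (k - j))"
      by (intro sum.mono_neutral_right) (auto simp: not_le not_less Suc_le_eq)
    finally show ?thesis .
  qed
  consider "k = 0" | "k = 1" | "k \<ge> 2" by linarith
  thus "tH $ k = (tG * tG + rat_fps (1/2) * tP) $ k"
  proof cases
    case 3
    thus ?thesis using t_even_convolution[OF 3] by (simp add: tH_def sq tP half left_diff_distrib)
  qed (simp_all add: tH_def sq tP half del: fps_mult_nth_0 fps_mult_nth_1')
qed

lemma theta_tP: "theta tP = tP"
  by (auto simp: fps_eq_iff tP_def)

lemma theta_tH: "theta tH = 2 * tG * tH + tH"
proof -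
  have "theta tH = theta (tG * tG) + theta (rat_fps (1/2) * tP)"
    by (subst tH_eq) (rule theta_add)
  also have "\<dots> = tG * theta tG + tG * theta tG + rat_fps (1/2) * tP"
    unfolding theta_scale theta_tP by (simp add: theta_mult mult_ac)
  also have "\<dots> = 2 * tG * tH + ((rat_fps (1/2) + rat_fps (1/2)) * tG * tG + rat_fps (1/2) * tP)"
    by (simp add: theta_tG algebra_simps)
  also have "(rat_fps (1/2) + rat_fps (1/2)) * tG * tG + rat_fps (1/2) * tP = tH"
    by (simp only: rat_fps_half tH_eq) simp
  finally show ?thesis .
qed

text \<open>
  Solved for the first term, this expresses \<open>tG\<^sup>m\<^sup>+\<^sup>1 tH\<close> through \<open>\<theta>(tG\<^sup>m tH)\<close> and elements with smaller
  powers of \<open>tG\<close>. For \<open>m = 0\<close> the last term has coefficient zero, so the truncated \<open>m - 1\<close> does no harm.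
\<close>

lemma theta_tG_power_tH:
  "theta (tG ^ m * tH) = of_nat (m + 2) * (tG ^ Suc m * tH) + rat_fps (of_nat m / 2 + 1) * (tG ^ m * tH)
     + rat_fps (of_nat m / 2) * (tP * (tG ^ (m - 1) * tH))"
proof (cases m)
  case 0
  thus ?thesis by (simp add: theta_tH rat_fps_simps algebra_simps)
next
  case (Suc j)
  have g: "theta tG = tG * tG + rat_fps (1/2) * tG + rat_fps (1/2) * tP"
    by (simp add: theta_tG tH_eq algebra_simps)
  have c: "rat_fps (of_nat m / 2) = of_nat m * rat_fps (1/2)"
    by (simp flip: rat_fps_simps)
  show ?thesis unfolding theta_mult theta_power g theta_tH rat_fps_simps(3) rat_fps_simps(2) c
    by (simp add: Suc algebra_simps)
qed

text \<open>
  Spans the part of weight at most \<open>w\<close> of the ideal of \<open>tH\<close>, where \<open>tP\<close> and \<open>tH\<close> have weight two and \<open>tG\<close> has weight one.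
\<close>

definition ideal_basis :: "nat \<Rightarrow> real fps set" where
  "ideal_basis w = {tP ^ l * (tG ^ m * tH) | l m. 2 * l + m + 2 \<le> w}"

lemma ideal_basisI: "2 * l + m + 2 \<le> w \<Longrightarrow> tP ^ l * (tG ^ m * tH) \<in> rat_span (ideal_basis w)"
  by (rule rat_span.base) (auto simp: ideal_basis_def)

lemma ideal_theta:
  assumes "F \<in> rat_span (ideal_basis w)"
  shows "theta F \<in> rat_span (ideal_basis (w + 1))"
proof (rule rat_span_linear[OF theta_add theta_scale _ assms])
  fix b assume "b \<in> ideal_basis w"
  then obtain l m where b: "b = tP ^ l * (tG ^ m * tH)" "2 * l + m + 2 \<le> w"
    by (auto simp: ideal_basis_def)
  have "theta (tP ^ l) = of_nat l * tP ^ l"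
    unfolding theta_power theta_tP by (cases l) (simp_all add: mult_ac)
  hence eq: "theta b = of_nat l * (tP ^ l * (tG ^ m * tH)) + of_nat (m + 2) * (tP ^ l * (tG ^ Suc m * tH))
      + rat_fps (of_nat m / 2 + 1) * (tP ^ l * (tG ^ m * tH)) + rat_fps (of_nat m / 2) * (tP ^ Suc l * (tG ^ (m - 1) * tH))"
    unfolding b theta_mult[of "tP ^ l"] theta_tG_power_tH by (simp add: algebra_simps)
  have A: "rat_fps (of_nat m / 2) * (tP ^ Suc l * (tG ^ (m - 1) * tH)) \<in> rat_span (ideal_basis (w + 1))"
  proof (cases m)
    case (Suc j)
    thus ?thesis using b by (intro rat_span.scale ideal_basisI) auto
  qed (simp add: rat_fps_simps rat_span.zero)
  show "theta b \<in> rat_span (ideal_basis (w + 1))" unfolding eq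
    by (intro rat_span.add A rat_span_of_nat ideal_basisI rat_span.scale[OF ideal_basisI]) (use b in auto)
qed

text \<open>
  The target for products of at most \<open>n\<close> single series. The powers of \<open>tG\<close> are bounded by the number of
  factors and not by the weight, which is larger if the factors involve \<open>\<theta>\<close>.
\<close>

definition power_basis :: "nat \<Rightarrow> nat \<Rightarrow> real fps set" where
  "power_basis n w = ideal_basis w \<union> {tG ^ i | i. i \<le> n}"

text \<open>The target for one single series: a multiple of \<open>tG\<close> modulo the ideal.\<close>

definition linear_basis :: "nat \<Rightarrow> real fps set" where
  "linear_basis d = ideal_basis d \<union> {tG}"

text \<open>Modulo the ideal, \<open>\<theta> tG\<close> is again a multiple of \<open>tG\<close>, because \<open>\<theta> tG = tG/2 + tH\<close>.\<close>

lemma linear_theta: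
  assumes "F \<in> rat_span (linear_basis d)" "d \<ge> 1"
  shows "theta F \<in> rat_span (linear_basis (d + 1))"
proof (rule rat_span_linear[OF theta_add theta_scale _ assms(1)])
  fix b assume "b \<in> linear_basis d"
  then consider "b \<in> ideal_basis d" | "b = tG" by (auto simp: linear_basis_def)
  thus "theta b \<in> rat_span (linear_basis (d + 1))"
  proof cases
    case 1
    hence "theta b \<in> rat_span (ideal_basis (d + 1))" by (intro ideal_theta rat_span.base)
    thus ?thesis by (rule rat_span_mono[rotated]) (auto simp: linear_basis_def intro: rat_span.base)
  next
    case 2
    have "tH \<in> ideal_basis (d + 1)" using assms(2)
      unfolding ideal_basis_def by (intro CollectI exI[of _ 0]) auto
    thus ?thesis unfolding 2 theta_tG
      by (intro rat_span.add rat_span.scale rat_span.base) (auto simp: linear_basis_def)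
  qed
qed

lemma ideal_basis_mono: "w \<le> w' \<Longrightarrow> ideal_basis w \<subseteq> ideal_basis w'"
  unfolding ideal_basis_def using le_trans by blast

lemma linear_mono:
  assumes "d \<le> d'" "F \<in> rat_span (linear_basis d)"
  shows "F \<in> rat_span (linear_basis d')"
  by (rule rat_span_mono[OF _ assms(2)])
     (use ideal_basis_mono[OF assms(1)] in \<open>auto simp: linear_basis_def intro: rat_span.base\<close>)

lemma power_mono_basis:
  assumes "w \<le> w'" "n \<le> n'" "F \<in> rat_span (power_basis n w)"
  shows "F \<in> rat_span (power_basis n' w')"
proof (rule rat_span_mono[OF _ assms(3)], rule subsetI, rule rat_span.base)
  fix b assume "b \<in> power_basis n w"
  thus "b \<in> power_basis n' w'"
    unfolding power_basis_def using ideal_basis_mono[OF assms(1)] le_trans[OF _ assms(2)] by blast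
qed

text \<open>
  Multiplication by a further single series. The bound \<open>n \<le> w\<close> ensures that \<open>tG\<^sup>i\<close> with \<open>i \<le> n\<close> times an element of the
  ideal stays within weight \<open>d + w\<close>.
\<close>

lemma linear_mult_power:
  assumes "F \<in> rat_span (linear_basis d)" "F' \<in> rat_span (power_basis n w)" "n \<le> w" "d \<ge> 1"
  shows "F * F' \<in> rat_span (power_basis (Suc n) (d + w))"
proof (rule rat_span_mult[OF _ assms(1,2)])
  have JC: "tP ^ l * (tG ^ m * tH) \<in> rat_span (power_basis (Suc n) (d + w))" if "2 * l + m + 2 \<le> d + w" for l m
    using that by (intro rat_span.base) (auto simp: power_basis_def ideal_basis_def)
  fix b b' assume b: "b \<in> linear_basis d" "b' \<in> power_basis n w"
  show "b * b' \<in> rat_span (power_basis (Suc n) (d + w))"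
  proof (cases "b = tG")
    case True
    from b(2) consider l m where "b' = tP ^ l * (tG ^ m * tH)" "2 * l + m + 2 \<le> w" | i where "b' = tG ^ i" "i \<le> n"
      by (auto simp: power_basis_def ideal_basis_def)
    thus ?thesis
    proof cases
      case 1
      have eq: "b * b' = tP ^ l * (tG ^ Suc m * tH)" by (simp add: True 1 mult_ac)
      show ?thesis unfolding eq by (rule JC) (use 1 assms in simp)
    next
      case 2
      have eq: "b * b' = tG ^ Suc i" by (simp add: True 2)
      have "tG ^ Suc i \<in> power_basis (Suc n) (d + w)"
        unfolding power_basis_def using 2(2) by (intro UnI2 CollectI exI[of _ "Suc i"]) simp
      thus ?thesis unfolding eq by (rule rat_span.base)
    qed
  next
    case False
    then obtain l m where lm: "b = tP ^ l * (tG ^ m * tH)" "2 * l + m + 2 \<le> d"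
      using b by (auto simp: linear_basis_def ideal_basis_def)
    from b(2) consider l' m' where "b' = tP ^ l' * (tG ^ m' * tH)" "2 * l' + m' + 2 \<le> w" | i where "b' = tG ^ i" "i \<le> n"
      by (auto simp: power_basis_def ideal_basis_def)
    thus ?thesis
    proof cases
      case 1
      have "b * b' = (tP ^ (l + l') * (tG ^ (m + m') * tH)) * tH" by (simp add: lm 1 power_add mult_ac)
      also have "\<dots> = tP ^ (l + l') * (tG ^ (m + m' + 2) * tH) + rat_fps (1/2) * (tP ^ Suc (l + l') * (tG ^ (m + m') * tH))"
        by (subst (2) tH_eq) (simp add: algebra_simps)
      finally have eq: "b * b' = \<dots>" .
      show ?thesis unfolding eq by (intro rat_span.add rat_span.scale JC) (use lm 1 in simp_all)
    next
      case 2
      have eq: "b * b' = tP ^ l * (tG ^ (m + i) * tH)" by (simp add: lm 2 power_add mult_ac)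
      show ?thesis unfolding eq by (rule JC) (use lm 2 assms in simp)
    qed
  qed
qed

text \<open>The series \<open>X / (1 - X)\<close>, whose substitution \<open>X \<mapsto> X / m\<^sup>2\<close> generates the powers \<open>m\<^bsup>-2k\<^esup>\<close>.\<close>

definition geo :: "real fps" where "geo = Abs_fps (\<lambda>k. if k = 0 then 0 else 1)"

lemma theta_geo: "theta geo = geo + geo * geo"
proof (rule fps_ext)
  fix k
  have "(geo * geo) $ k = (\<Sum>j=0..k. if j \<in> {1..<k} then 1 else 0)"
    unfolding fps_mult_nth by (intro sum.cong refl) (auto simp: geo_def)
  also have "\<dots> = (\<Sum>j\<in>{0..k} \<inter> {1..<k}. 1)" by (rule sum.inter_restrict[symmetric]) simp
  also have "{0..k} \<inter> {1..<k} = {1..<k}" by auto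
  finally show "theta geo $ k = (geo + geo * geo) $ k"
    by (auto simp: geo_def)
qed

text \<open>
  Spans the polynomials of degree at most \<open>d\<close> without constant term in \<open>geo\<close>. Their coefficient sequences are
  the polynomials in \<open>k\<close> of degree less than \<open>d\<close>, restricted to \<open>k \<ge> 1\<close>; in this form closure under products is clear.
\<close>

definition geo_basis :: "nat \<Rightarrow> real fps set" where
  "geo_basis d = {geo ^ Suc q | q. q < d}"

lemma geo_basisI: "q < d \<Longrightarrow> geo ^ Suc q \<in> rat_span (geo_basis d)"
  by (rule rat_span.base) (auto simp: geo_basis_def)

lemma geo_theta:
  assumes "u \<in> rat_span (geo_basis d)"
  shows "theta u \<in> rat_span (geo_basis (Suc d))"
proof (rule rat_span_linear[OF theta_add theta_scale _ assms])
  fix b assume "b \<in> geo_basis d"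
  then obtain q where q: "b = geo ^ Suc q" "q < d" by (auto simp: geo_basis_def)
  have eq: "theta b = of_nat (Suc q) * geo ^ Suc q + of_nat (Suc q) * geo ^ Suc (Suc q)"
    unfolding q theta_power theta_geo by (simp add: algebra_simps)
  show "theta b \<in> rat_span (geo_basis (Suc d))"
    unfolding eq by (intro rat_span.add rat_span_of_nat geo_basisI) (use q in simp_all)
qed

lemma geo_mult:
  assumes "u \<in> rat_span (geo_basis d)" "v \<in> rat_span (geo_basis d')"
  shows "u * v \<in> rat_span (geo_basis (d + d'))"
proof (rule rat_span_mult[OF _ assms])
  fix b b' assume "b \<in> geo_basis d" "b' \<in> geo_basis d'"
  then obtain q q' where "b = geo ^ Suc q" "q < d" "b' = geo ^ Suc q'" "q' < d'" by (auto simp: geo_basis_def)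
  hence "b * b' = geo ^ Suc (Suc (q + q'))" "Suc (q + q') < d + d'" by (simp_all add: power_add mult_ac)
  thus "b * b' \<in> rat_span (geo_basis (d + d'))" using geo_basisI by metis
qed

lemma geo_nth_0: "u \<in> rat_span (geo_basis d) \<Longrightarrow> u $ 0 = 0"
  by (induction rule: rat_span.induct) (auto simp: geo_basis_def geo_def)

text \<open>
  The Hadamard product with \<open>tG\<close>; it is the sum of \<open>u(X/m\<^sup>2)\<close> over all odd \<open>m\<close> when \<open>u\<close> has no constant term.
\<close>

definition t_hadamard :: "real fps \<Rightarrow> real fps" where
  "t_hadamard u = Abs_fps (\<lambda>k. u $ k * t_even k)"

text \<open>
  The Hadamard product commutes with \<open>\<theta>\<close> and maps \<open>geo\<close> to \<open>tG\<close>. Solving the formula for \<open>\<theta>(geo\<^sup>q\<^sup>+\<^sup>1)\<close> for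
  \<open>geo\<^sup>q\<^sup>+\<^sup>2\<close> carries the claim from one power of \<open>geo\<close> to the next.
\<close>

lemma t_hadamard_geo:
  assumes "u \<in> rat_span (geo_basis d)" "d \<ge> 1"
  shows "t_hadamard u \<in> rat_span (linear_basis d)"
proof (rule rat_span_linear[OF _ _ _ assms(1)])
  have add: "t_hadamard (F + F') = t_hadamard F + t_hadamard F'" and scale: "t_hadamard (rat_fps c * F) = rat_fps c * t_hadamard F"
    and th: "t_hadamard (theta F) = theta (t_hadamard F)" for c F F'
    by (simp_all add: t_hadamard_def fps_eq_iff distrib_right mult.assoc)
  show "t_hadamard (F + F') = t_hadamard F + t_hadamard F'" "t_hadamard (rat_fps c * F) = rat_fps c * t_hadamard F" for c F F'
    by (rule add scale)+
  have *: "t_hadamard (geo ^ Suc q) \<in> rat_span (linear_basis (Suc q))" for q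
  proof (induction q)
    case 0
    have "t_hadamard geo = tG" by (simp add: t_hadamard_def fps_eq_iff geo_def)
    thus ?case by (simp add: linear_basis_def rat_span.base)
  next
    case (Suc q)
    have "theta (geo ^ Suc q) = of_nat (Suc q) * geo ^ Suc q + of_nat (Suc q) * geo ^ Suc (Suc q)"
      unfolding theta_power theta_geo by (simp add: algebra_simps)
    hence "geo ^ Suc (Suc q) + geo ^ Suc q = rat_fps (1 / of_nat (Suc q)) * theta (geo ^ Suc q)"
      using rat_fps_inverse[of "of_nat (Suc q)" "geo ^ Suc (Suc q) + geo ^ Suc q"]
      by (simp add: rat_fps_simps algebra_simps del: of_nat_Suc power_Suc)
    hence "t_hadamard (geo ^ Suc (Suc q)) + t_hadamard (geo ^ Suc q) = rat_fps (1 / of_nat (Suc q)) * theta (t_hadamard (geo ^ Suc q))"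
      by (metis add scale th)
    hence "t_hadamard (geo ^ Suc (Suc q)) = rat_fps (1 / of_nat (Suc q)) * theta (t_hadamard (geo ^ Suc q)) - t_hadamard (geo ^ Suc q)"
      by (simp add: algebra_simps)
    thus ?case using Suc linear_theta[OF Suc] linear_mono[OF _ Suc]
      by (auto intro!: rat_span_diff rat_span.scale)
  qed
  fix b assume "b \<in> geo_basis d"
  then obtain q where "b = geo ^ Suc q" "q < d" by (auto simp: geo_basis_def)
  thus "t_hadamard b \<in> rat_span (linear_basis d)" using *[of q] linear_mono[of "Suc q" d] by simp
qed

text \<open>The generating function of \<open>k\<^sup>a\<close> for \<open>k \<ge> 1\<close>.\<close>

definition pow_fps :: "nat \<Rightarrow> real fps" where
  "pow_fps a = (theta ^^ a) geo"

lemma pow_fps_nth: "pow_fps a $ k = (if k = 0 then 0 else real k ^ a)"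
proof -
  have "(theta ^^ a) F $ k = real k ^ a * F $ k" for F
    by (induction a) auto
  thus ?thesis by (simp add: pow_fps_def geo_def)
qed

lemma pow_fps_geo: "pow_fps a \<in> rat_span (geo_basis (Suc a))"
proof (induction a)
  case 0
  show ?case by (auto simp: pow_fps_def geo_basis_def intro!: rat_span.base)
next
  case (Suc a)
  thus ?case using geo_theta by (simp add: pow_fps_def)
qed

section \<open>Elements of the algebra as linear combinations of shifted t-values\<close>

text \<open>
  Series whose coefficients, from degree \<open>K\<close> on, have the form of the right-hand side of the theorem with
  \<open>p\<^sup>l\<close> in place of \<open>\<zeta>(2l)\<close>. The number \<open>w\<close> bounds the weight, so that \<open>c l\<close> has degree at most \<open>w - 2l - 1\<close>, and \<open>v\<close>
  bounds the range of \<open>l\<close> separately, since \<open>l\<close> is in general more restricted than the weight demands.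
  Writing the bounds for nonzero \<open>c l\<close> only avoids subtraction and the degree of the zero polynomial.
\<close>

definition t_form :: "nat \<Rightarrow> nat \<Rightarrow> nat \<Rightarrow> real fps set" where
  "t_form w v K = {F. \<exists>c :: nat \<Rightarrow> rat poly.
     (\<forall>l. c l \<noteq> 0 \<longrightarrow> degree (c l) + 2 * l + 1 \<le> w \<and> 2 * l + 1 \<le> v) \<and>
     (\<forall>k\<ge>K. F $ k = (\<Sum>l\<le>k. of_rat (poly (c l) (of_nat k)) * (t_even 1 ^ l * t_even (k - l))))}"

lemma t_formI:
  assumes "\<And>l. c l \<noteq> 0 \<Longrightarrow> degree (c l) + 2 * l + 1 \<le> w \<and> 2 * l + 1 \<le> v"
    and "\<And>k. k \<ge> K \<Longrightarrow> F $ k = (\<Sum>l\<le>k. of_rat (poly (c l) (of_nat k)) * (t_even 1 ^ l * t_even (k - l)))"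
  shows "F \<in> t_form w v K"
  using assms unfolding t_form_def by blast

lemma t_formE:
  assumes "F \<in> t_form w v K"
  obtains c :: "nat \<Rightarrow> rat poly"
  where "\<And>l. c l \<noteq> 0 \<Longrightarrow> degree (c l) + 2 * l + 1 \<le> w \<and> 2 * l + 1 \<le> v"
    and "\<And>k. k \<ge> K \<Longrightarrow> F $ k = (\<Sum>l\<le>k. of_rat (poly (c l) (of_nat k)) * (t_even 1 ^ l * t_even (k - l)))"
  using assms unfolding t_form_def by blast

lemma t_form_mono:
  assumes "F \<in> t_form w v K" "w \<le> w'" "v \<le> v'" "K \<le> K'"
  shows "F \<in> t_form w' v' K'"
proof -
  from assms(1) obtain c :: "nat \<Rightarrow> rat poly"
    where c: "\<And>l. c l \<noteq> 0 \<Longrightarrow> degree (c l) + 2 * l + 1 \<le> w \<and> 2 * l + 1 \<le> v"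
      and F: "\<And>k. k \<ge> K \<Longrightarrow> F $ k = (\<Sum>l\<le>k. of_rat (poly (c l) (of_nat k)) * (t_even 1 ^ l * t_even (k - l)))"
    by (rule t_formE) blast
  show ?thesis
    by (rule t_formI[of c]) (use c F assms(2-4) in \<open>force+\<close>)
qed

lemma t_form_zero: "(\<And>k. k \<ge> K \<Longrightarrow> F $ k = 0) \<Longrightarrow> F \<in> t_form w v K"
  by (rule t_formI[of "\<lambda>_. 0"]) auto

lemma t_form_add:
  assumes "F \<in> t_form w v K" "F' \<in> t_form w v K"
  shows "F + F' \<in> t_form w v K"
proof -
  from assms(1) obtain c :: "nat \<Rightarrow> rat poly"
    where c: "\<And>l. c l \<noteq> 0 \<Longrightarrow> degree (c l) + 2 * l + 1 \<le> w \<and> 2 * l + 1 \<le> v"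
      and F: "\<And>k. k \<ge> K \<Longrightarrow> F $ k = (\<Sum>l\<le>k. of_rat (poly (c l) (of_nat k)) * (t_even 1 ^ l * t_even (k - l)))"
    by (rule t_formE) blast
  from assms(2) obtain c' :: "nat \<Rightarrow> rat poly"
    where c': "\<And>l. c' l \<noteq> 0 \<Longrightarrow> degree (c' l) + 2 * l + 1 \<le> w \<and> 2 * l + 1 \<le> v"
      and F': "\<And>k. k \<ge> K \<Longrightarrow> F' $ k = (\<Sum>l\<le>k. of_rat (poly (c' l) (of_nat k)) * (t_even 1 ^ l * t_even (k - l)))"
    by (rule t_formE) blast
  show ?thesis
  proof (rule t_formI[of "\<lambda>l. c l + c' l"])
    fix l assume *: "c l + c' l \<noteq> 0"
    show "degree (c l + c' l) + 2 * l + 1 \<le> w \<and> 2 * l + 1 \<le> v"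
    proof (cases "c l = 0 \<or> c' l = 0")
      case True
      thus ?thesis using c[of l] c'[of l] * by auto
    next
      case False
      thus ?thesis using c[of l] c'[of l] degree_add_le_max[of "c l" "c' l"] by auto
    qed
  qed (simp add: F F' sum.distrib distrib_right of_rat_add)
qed

text \<open>Covers both multiplication by constants and \<open>\<theta>\<close>, which multiplies the coefficients by \<open>k\<close>.\<close>

lemma t_form_poly_mult:
  assumes "F \<in> t_form w v K" "\<And>k. F' $ k = of_rat (poly p (of_nat k)) * F $ k" "degree p \<le> d"
  shows "F' \<in> t_form (w + d) v K"
proof -
  from assms(1) obtain c :: "nat \<Rightarrow> rat poly"
    where c: "\<And>l. c l \<noteq> 0 \<Longrightarrow> degree (c l) + 2 * l + 1 \<le> w \<and> 2 * l + 1 \<le> v"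
      and F: "\<And>k. k \<ge> K \<Longrightarrow> F $ k = (\<Sum>l\<le>k. of_rat (poly (c l) (of_nat k)) * (t_even 1 ^ l * t_even (k - l)))"
    by (rule t_formE) blast
  show ?thesis
  proof (rule t_formI[of "\<lambda>l. p * c l"])
    fix l assume "p * c l \<noteq> 0"
    thus "degree (p * c l) + 2 * l + 1 \<le> w + d \<and> 2 * l + 1 \<le> v"
      using c[of l] assms(3) by (auto simp: degree_mult_eq)
  qed (simp add: assms(2) F sum_distrib_left of_rat_mult mult.assoc)
qed

lemma t_form_scale: "F \<in> t_form w v K \<Longrightarrow> rat_fps c * F \<in> t_form w v K"
  using t_form_poly_mult[of F w v K "rat_fps c * F" "[:c:]" 0] by simp

lemma t_form_theta: "F \<in> t_form w v K \<Longrightarrow> theta F \<in> t_form (w + 1) v K"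
  using t_form_poly_mult[of F w v K "theta F" "[:0, 1:]" 1] by simp

lemma t_form_qspan:
  assumes "B \<subseteq> t_form w v K"
  shows "rat_span B \<subseteq> t_form w v K"
proof
  fix F assume "F \<in> rat_span B"
  thus "F \<in> t_form w v K"
    by induction (use assms in \<open>auto intro: t_form_add t_form_scale t_form_zero\<close>)
qed

text \<open>
  Multiplication by \<open>tP\<close> shifts \<open>k\<close> and \<open>l\<close> by one, so the polynomials have to be composed with \<open>k - 1\<close>.
\<close>

lemma t_form_tP:
  assumes "F \<in> t_form w v 0"
  shows "tP * F \<in> t_form (w + 2) (v + 2) 0"
proof -
  from assms(1) obtain c :: "nat \<Rightarrow> rat poly"
    where c: "\<And>l. c l \<noteq> 0 \<Longrightarrow> degree (c l) + 2 * l + 1 \<le> w \<and> 2 * l + 1 \<le> v"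
      and F: "\<And>k. F $ k = (\<Sum>l\<le>k. of_rat (poly (c l) (of_nat k)) * (t_even 1 ^ l * t_even (k - l)))"
    by (rule t_formE) blast
  define c' where "c' l = (case l of 0 \<Rightarrow> 0 | Suc l' \<Rightarrow> pcompose (c l') [:-1, 1:])" for l
  show ?thesis
  proof (rule t_formI[of c'])
    fix l assume l: "c' l \<noteq> 0"
    then obtain l' where l': "l = Suc l'" "c' l = pcompose (c l') [:-1, 1:]"
      by (cases l) (auto simp: c'_def)
    hence "c l' \<noteq> 0" using l by auto
    thus "degree (c' l) + 2 * l + 1 \<le> w + 2 \<and> 2 * l + 1 \<le> v + 2"
      using c[of l'] l' by (simp add: degree_pcompose)
  next
    fix k
    show "(tP * F) $ k = (\<Sum>l\<le>k. of_rat (poly (c' l) (of_nat k)) * (t_even 1 ^ l * t_even (k - l)))"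
    proof (cases k)
      case 0
      thus ?thesis by (simp add: tP_mult_nth c'_def del: fps_mult_nth_0)
    next
      case (Suc j)
      have "(\<Sum>l\<le>k. of_rat (poly (c' l) (of_nat k)) * (t_even 1 ^ l * t_even (k - l))) =
        (\<Sum>l\<le>j. of_rat (poly (c' (Suc l)) (of_nat k)) * (t_even 1 ^ Suc l * t_even (k - Suc l)))"
        unfolding Suc by (subst sum.atMost_Suc_shift) (simp add: c'_def)
      also have "\<dots> = (\<Sum>l\<le>j. t_even 1 * (of_rat (poly (c l) (of_nat j)) * (t_even 1 ^ l * t_even (j - l))))"
        by (intro sum.cong refl) (simp add: c'_def Suc poly_pcompose)
      finally show ?thesis by (simp add: tP_mult_nth Suc F sum_distrib_left)
    qed
  qed
qed

lemma t_form_tP_power: "F \<in> t_form w v 0 \<Longrightarrow> tP ^ l * F \<in> t_form (w + 2 * l) (v + 2 * l) 0"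
proof (induction l)
  case (Suc l)
  from t_form_tP[OF Suc.IH[OF Suc.prems]] show ?case by (simp add: mult.assoc add_ac)
qed simp

lemma t_form_tG: "tG \<in> t_form 1 1 0"
proof (rule t_formI[of "\<lambda>l. if l = 0 then 1 else 0"])
  fix k :: nat
  have "(\<Sum>l\<le>k. of_rat (poly (if l = 0 then 1 else 0) (of_nat k)) * (t_even 1 ^ l * t_even (k - l))) =
     (\<Sum>l\<le>k. if l = 0 then t_even k else 0)"
    by (intro sum.cong refl) auto
  thus "tG $ k = (\<Sum>l\<le>k. of_rat (poly (if l = 0 then 1 else 0) (of_nat k)) * (t_even 1 ^ l * t_even (k - l)))"
    by simp
qed (auto split: if_splits)

lemma t_form_tH: "tH \<in> t_form 2 1 0"
proof -
  have "tH $ k = of_rat (poly [:- 1 / 2, 1:] (of_nat k)) * tG $ k" for k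
    by (simp add: tH_def of_rat_divide of_rat_diff left_diff_distrib del: fps_mult_nth_0)
  from t_form_poly_mult[OF t_form_tG this, of 1] show ?thesis by (simp add: numeral_2_eq_2)
qed

lemma t_form_diff: "F \<in> t_form w v K \<Longrightarrow> F' \<in> t_form w v K \<Longrightarrow> F - F' \<in> t_form w v K"
  using t_form_add[OF _ t_form_scale[of F' w v K "-1"], of F] by (simp add: rat_fps_simps)

text \<open>
  Induction on \<open>m\<close> by solving \<open>theta_tG_power_tH\<close> for the highest power of \<open>tG\<close>. The bound for \<open>l\<close> is one less
  than the weight because the recursion starts with \<open>tH\<close>, of weight two but with \<open>l = 0\<close> only.
\<close>

lemma tG_power_tH_t_form: "tG ^ m * tH \<in> t_form (m + 2) (m + 1) 0"
proof (induction m rule: less_induct)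
  case (less m)
  show ?case
  proof (cases m)
    case 0
    thus ?thesis using t_form_tH by (simp add: numeral_2_eq_2)
  next
    case (Suc j)
    let ?n = "of_nat (j + 2) :: rat"
    have IH: "tG ^ j * tH \<in> t_form (j + 2) (j + 1) 0" using less.IH[of j] Suc by simp
    have "rat_fps (of_nat j / 2) * (tP * (tG ^ (j - 1) * tH)) \<in> t_form (j + 3) (j + 2) 0"
    proof (cases j)
      case (Suc i)
      have "tG ^ i * tH \<in> t_form (i + 2) (i + 1) 0" using less.IH[of i] Suc \<open>m = Suc j\<close> by simp
      from t_form_tP[OF this] show ?thesis by (intro t_form_scale) (simp add: Suc numeral_eq_Suc)
    qed (simp add: rat_fps_simps t_form_zero)
    moreover have "rat_fps (of_nat j / 2 + 1) * (tG ^ j * tH) \<in> t_form (j + 3) (j + 2) 0"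
      by (rule t_form_scale, rule t_form_mono[OF IH]) auto
    moreover have "theta (tG ^ j * tH) \<in> t_form (j + 3) (j + 2) 0"
      by (rule t_form_mono[OF t_form_theta[OF IH]]) auto
    ultimately have "theta (tG ^ j * tH) - rat_fps (of_nat j / 2 + 1) * (tG ^ j * tH)
        - rat_fps (of_nat j / 2) * (tP * (tG ^ (j - 1) * tH)) \<in> t_form (j + 3) (j + 2) 0"
      by (intro t_form_diff)
    also have "theta (tG ^ j * tH) - rat_fps (of_nat j / 2 + 1) * (tG ^ j * tH)
        - rat_fps (of_nat j / 2) * (tP * (tG ^ (j - 1) * tH)) = rat_fps ?n * (tG ^ Suc j * tH)"
      unfolding theta_tG_power_tH by (simp only: rat_fps_simps) simp
    finally have "rat_fps (1 / ?n) * (rat_fps ?n * (tG ^ Suc j * tH)) \<in> t_form (j + 3) (j + 2) 0"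
      by (rule t_form_scale)
    moreover have "rat_fps (1 / ?n) * (rat_fps ?n * (tG ^ Suc j * tH)) = tG ^ Suc j * tH"
      by (rule rat_fps_inverse) (simp only: of_nat_eq_0_iff)
    ultimately have "tG ^ Suc j * tH \<in> t_form (j + 3) (j + 2) 0" by (simp only:)
    thus ?thesis using Suc by (simp add: numeral_eq_Suc)
  qed
qed

lemma ideal_basis_t_form: "ideal_basis w \<subseteq> t_form w (w - 1) 0"
proof
  fix b assume "b \<in> ideal_basis w"
  then obtain l m where b: "b = tP ^ l * (tG ^ m * tH)" "2 * l + m + 2 \<le> w"
    by (auto simp: ideal_basis_def)
  show "b \<in> t_form w (w - 1) 0" unfolding b(1)
    by (rule t_form_mono[OF t_form_tP_power[OF tG_power_tH_t_form]]) (use b in auto)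
qed

text \<open>
  Modulo the ideal \<open>tG\<^sup>2 = -tP/2\<close>. This leaves \<open>tP\<^sup>l tG\<close> for odd \<open>i\<close>; for even \<open>i\<close> it leaves \<open>tP\<^sup>l\<close> with \<open>l < n\<close>, which has no
  coefficient in degree \<open>n\<close> or higher. This is the only place where the coefficients below degree \<open>n\<close> have to be discarded.
\<close>

lemma tG_power_t_form:
  assumes "i \<le> n" "n \<ge> 1"
  shows "tG ^ i \<in> t_form i (max (i - 1) n) n"
proof -
  have "\<exists>j\<in>rat_span (ideal_basis i). tG ^ i = rat_fps (-1/2) ^ (i div 2) * (tP ^ (i div 2) * (if odd i then tG else 1)) + j" for i
  proof (induction i rule: less_induct)
    case (less i)
    consider "i = 0" | "i = 1" | i' where "i = i' + 2"
      by (metis One_nat_def Suc_1 add.commute add_2_eq_Suc' not0_implies_Suc)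
    thus ?case
    proof cases
      case 3
      from less[of i'] 3 obtain j where j: "j \<in> rat_span (ideal_basis i')"
        and eq: "tG ^ i' = rat_fps (-1/2) ^ (i' div 2) * (tP ^ (i' div 2) * (if odd i' then tG else 1)) + j"
        by auto
      have "tG ^ i = tG ^ i' * tH + rat_fps (-1/2) * (tP * tG ^ i')"
        using rat_fps_simps(5)[of "1/2"] by (simp add: 3 tH_eq power_add power2_eq_square algebra_simps)
      also have "tP * tG ^ i' = tP * (rat_fps (-1/2) ^ (i' div 2) * (tP ^ (i' div 2) * (if odd i' then tG else 1))) + tP * j"
        by (simp only: eq distrib_left)
      finally have "tG ^ i = rat_fps (-1/2) ^ (i div 2) * (tP ^ (i div 2) * (if odd i then tG else 1)) +
          (tG ^ i' * tH + rat_fps (-1/2) * (tP * j))"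
        by (simp add: 3 algebra_simps)
      moreover have "tG ^ i' * tH \<in> rat_span (ideal_basis i)"
        using ideal_basisI[of 0 i' i] 3 by simp
      moreover have "tP * j \<in> rat_span (ideal_basis i)"
      proof (rule rat_span_linear[OF _ _ _ j])
        fix b assume "b \<in> ideal_basis i'"
        then obtain l m where b: "b = tP ^ l * (tG ^ m * tH)" "2 * l + m + 2 \<le> i'"
          by (auto simp: ideal_basis_def)
        have "tP * b = tP ^ Suc l * (tG ^ m * tH)" by (simp add: b mult.assoc)
        also have "\<dots> \<in> rat_span (ideal_basis i)" by (rule ideal_basisI) (use b 3 in simp)
        finally show "tP * b \<in> rat_span (ideal_basis i)" .
      qed (auto simp: distrib_left mult.left_commute)
      ultimately show ?thesis by (intro bexI[of _ "tG ^ i' * tH + rat_fps (-1/2) * (tP * j)"] rat_span.add rat_span.scale)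
    qed (auto intro!: bexI[of _ 0] rat_span.zero)
  qed
  then obtain j where j: "j \<in> rat_span (ideal_basis i)"
    and eq: "tG ^ i = rat_fps (-1/2) ^ (i div 2) * (tP ^ (i div 2) * (if odd i then tG else 1)) + j"
    by blast
  have qp: "rat_fps (-1/2) ^ (i div 2) = rat_fps ((-1/2) ^ (i div 2))"
    by (simp add: rat_fps_def of_rat_power fps_const_power)
  have "tP ^ (i div 2) * (if odd i then tG else 1) \<in> t_form i (max (i - 1) n) n"
  proof (cases "odd i")
    case True
    then obtain m where m: "i = 2 * m + 1" by (elim oddE)
    show ?thesis using True
      by (simp, intro t_form_mono[OF t_form_tP_power[OF t_form_tG]]) (use m assms in auto)
  next
    case False
    hence "i div 2 < n" using assms by auto
    thus ?thesis using False
      by (intro t_form_zero) (auto simp: tP_def power_mult_distrib fps_const_power fps_X_power_nth)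
  qed
  moreover have "j \<in> t_form i (max (i - 1) n) n"
    by (rule t_form_mono[OF subsetD[OF t_form_qspan[OF ideal_basis_t_form] j]]) auto
  ultimately show ?thesis unfolding eq qp by (intro t_form_add t_form_scale)
qed

theorem power_basis_t_form:
  assumes "F \<in> rat_span (power_basis n w)" "1 \<le> n" "n \<le> w"
  shows "F \<in> t_form w (max (w - 1) n) n"
proof -
  have "power_basis n w \<subseteq> t_form w (max (w - 1) n) n"
  proof
    fix b assume "b \<in> power_basis n w"
    then consider "b \<in> ideal_basis w" | i where "b = tG ^ i" "i \<le> n" by (auto simp: power_basis_def)
    thus "b \<in> t_form w (max (w - 1) n) n"
    proof cases
      case 1
      thus ?thesis using ideal_basis_t_form[of w] by (auto intro: t_form_mono)
    next
      case 2
      show ?thesis unfolding 2(1)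
        by (rule t_form_mono[OF tG_power_t_form[OF 2(2) assms(2)]]) (use 2 assms in auto)
    qed
  qed
  from t_form_qspan[OF this] assms(1) show ?thesis by blast
qed

section \<open>Weighted sums over tuples\<close>

definition tuples :: "'b set \<Rightarrow> nat \<Rightarrow> 'b list set" where
  "tuples M n = {ms. set ms \<subseteq> M \<and> length ms = n}"

lemma tuples_0: "tuples M 0 = {[]}"
  by (auto simp: tuples_def)

lemma finite_tuples: "finite M \<Longrightarrow> finite (tuples M n)"
  unfolding tuples_def by (rule finite_lists_length_eq)

lemma sum_tuples_Suc:
  "(\<Sum>ms\<in>tuples M (Suc n). f ms) = (\<Sum>x\<in>M. \<Sum>xs\<in>tuples M n. f (x # xs))"
proof -
  have "(\<Sum>ms\<in>tuples M (Suc n). f ms) = (\<Sum>(x, xs)\<in>M \<times> tuples M n. f (x # xs))"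
    by (rule sum.reindex_bij_witness[of _ "\<lambda>(x, xs). x # xs" "\<lambda>ms. (hd ms, tl ms)"])
       (auto simp: tuples_def length_Suc_conv)
  thus ?thesis by (simp add: sum.cartesian_product)
qed

text \<open>
  For \<open>e = 1\<close> this is the product of the factorials of the multiplicities, for \<open>e = -1\<close> the indicator of
  distinct entries. One recursion with a parameter lets the same argument treat both kinds of multiple values.
\<close>

fun tuple_weight :: "'r::comm_ring_1 \<Rightarrow> 'b list \<Rightarrow> 'r" where
  "tuple_weight e [] = 1"
| "tuple_weight e (x # xs) = tuple_weight e xs * (1 + e * of_nat (count (mset xs) x))"

definition tuple_sum :: "'r::comm_ring_1 \<Rightarrow> 'b set \<Rightarrow> ('b \<Rightarrow> 'r) list \<Rightarrow> 'r" where
  "tuple_sum e M gs = (\<Sum>ms\<in>tuples M (length gs). tuple_weight e ms * (\<Prod>i<length gs. (gs ! i) (ms ! i)))"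

lemma tuple_sum_Nil [simp]: "tuple_sum e M [] = 1"
  by (simp add: tuple_sum_def tuples_0)

lemma of_nat_count_mset: "of_nat (count (mset xs) x) = (\<Sum>j<length xs. if xs ! j = x then 1 else 0)"
  by (induction xs) (simp_all add: sum.lessThan_Suc_shift del: sum.lessThan_Suc)

text \<open>
  The first entry \<open>x\<close> either is free, or it coincides with one of the other entries, in which case the two
  factors are multiplied. The weight counts each coincidence with \<open>e\<close>. This is the stuffle product.
\<close>

lemma tuple_sum_Cons:
  assumes M: "finite M"
  shows "tuple_sum e M (g # gs) =
    (\<Sum>x\<in>M. g x) * tuple_sum e M gs + e * (\<Sum>j<length gs. tuple_sum e M (gs[j := (\<lambda>x. (gs ! j) x * g x)]))"
proof -
  define n where "n = length gs"
  define p where "p ms = (\<Prod>i<n. (gs ! i) (ms ! i))" for ms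
  have upd: "(\<Prod>i<n. (gs[j := (\<lambda>x. (gs ! j) x * g x)] ! i) (ms ! i)) = p ms * g (ms ! j)" if "j < n" for j ms
  proof -
    have "(\<Prod>i<n. (gs[j := (\<lambda>x. (gs ! j) x * g x)] ! i) (ms ! i)) =
        (\<Prod>i<n. (gs ! i) (ms ! i) * (if i = j then g (ms ! j) else 1))"
      by (intro prod.cong refl) (use that in \<open>auto simp: n_def nth_list_update\<close>)
    thus ?thesis using that by (simp add: prod.distrib p_def)
  qed
  have "tuple_sum e M (g # gs) = (\<Sum>x\<in>M. \<Sum>ms\<in>tuples M n. tuple_weight e ms * (1 + e * of_nat (count (mset ms) x)) * (g x * p ms))"
    unfolding tuple_sum_def
    by (simp add: sum_tuples_Suc prod.lessThan_Suc_shift n_def p_def del: prod.lessThan_Suc)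
  also have "\<dots> = (\<Sum>x\<in>M. \<Sum>ms\<in>tuples M n. g x * (tuple_weight e ms * p ms)) +
      (\<Sum>x\<in>M. \<Sum>ms\<in>tuples M n. e * (tuple_weight e ms * p ms) * (of_nat (count (mset ms) x) * g x))"
    by (simp add: sum.distrib[symmetric] algebra_simps)
  also have "(\<Sum>x\<in>M. \<Sum>ms\<in>tuples M n. g x * (tuple_weight e ms * p ms)) = (\<Sum>x\<in>M. g x) * tuple_sum e M gs"
    by (simp add: tuple_sum_def n_def p_def sum_product)
  also have "(\<Sum>x\<in>M. \<Sum>ms\<in>tuples M n. e * (tuple_weight e ms * p ms) * (of_nat (count (mset ms) x) * g x)) =
      (\<Sum>ms\<in>tuples M n. e * (tuple_weight e ms * p ms) * (\<Sum>x\<in>M. of_nat (count (mset ms) x) * g x))"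
    by (subst sum.swap) (simp add: sum_distrib_left)
  also have "\<dots> = (\<Sum>ms\<in>tuples M n. e * (tuple_weight e ms * p ms) * (\<Sum>j<n. g (ms ! j)))"
  proof (intro sum.cong refl)
    fix ms assume ms: "ms \<in> tuples M n"
    have "(\<Sum>x\<in>M. of_nat (count (mset ms) x) * g x) = (\<Sum>x\<in>M. \<Sum>j<n. if ms ! j = x then g x else 0)"
      using ms by (intro sum.cong refl)
        (auto simp: of_nat_count_mset tuples_def sum_distrib_right intro!: sum.cong)
    also have "\<dots> = (\<Sum>j<n. \<Sum>x\<in>M. if ms ! j = x then g x else 0)"
      by (rule sum.swap)
    also have "\<dots> = (\<Sum>j<n. g (ms ! j))"
      using ms M by (intro sum.cong refl) (auto simp: tuples_def subset_iff)
    finally show "e * (tuple_weight e ms * p ms) * (\<Sum>x\<in>M. of_nat (count (mset ms) x) * g x) =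
       e * (tuple_weight e ms * p ms) * (\<Sum>j<n. g (ms ! j))" by simp
  qed
  also have "\<dots> = (\<Sum>j<n. \<Sum>ms\<in>tuples M n. e * (tuple_weight e ms * (p ms * g (ms ! j))))"
    by (subst sum.swap) (simp add: sum_distrib_left mult.assoc)
  also have "\<dots> = (\<Sum>j<n. e * tuple_sum e M (gs[j := (\<lambda>x. (gs ! j) x * g x)]))"
  proof (intro sum.cong refl)
    fix j assume "j \<in> {..<n}"
    thus "(\<Sum>ms\<in>tuples M n. e * (tuple_weight e ms * (p ms * g (ms ! j)))) =
        e * tuple_sum e M (gs[j := (\<lambda>x. (gs ! j) x * g x)])"
      unfolding tuple_sum_def sum_distrib_left by (simp add: upd flip: n_def)
  qed
  finally show ?thesis by (simp add: n_def sum_distrib_left)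
qed

lemma sum_tuples_prod:
  assumes "finite M"
  shows "(\<Sum>ms\<in>tuples M n. \<Prod>i<n. g i (ms ! i)) = (\<Prod>i<n. \<Sum>x\<in>M. g i x :: 'r :: comm_ring_1)"
proof (induction n arbitrary: g)
  case (Suc n)
  show ?case
    by (simp add: sum_tuples_Suc prod.lessThan_Suc_shift Suc[of "\<lambda>i. g (Suc i)"]
        sum_distrib_left[symmetric] sum_distrib_right[symmetric] del: prod.lessThan_Suc)
qed (simp add: tuples_0)

text \<open>The orbit of a tuple under reordering has \<open>n!\<close> divided by the product of the factorials of the multiplicities as its size.\<close>

lemma card_permutations_tuple_weight:
  "of_nat (card (permutations_of_multiset (mset ms))) * tuple_weight 1 ms = (fact (length ms) :: 'r :: {comm_ring_1, semiring_char_0})"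
proof (induction ms)
  case (Cons x xs)
  let ?c = "count (mset xs) x"
  have "(of_nat (card (permutations_of_multiset (mset (x # xs)))) * tuple_weight 1 (x # xs) :: 'r) =
    of_nat (card (permutations_of_multiset (mset xs + {#x#})) * (?c + 1)) * tuple_weight 1 xs"
    by (simp add: algebra_simps)
  also have "\<dots> = of_nat (length xs + 1) * (of_nat (card (permutations_of_multiset (mset xs))) * tuple_weight 1 xs)"
    unfolding card_permutations_of_multiset_insert_aux by (simp add: algebra_simps)
  finally show ?case by (simp only: Cons) (simp add: algebra_simps)
qed simp

text \<open>
  Group the tuples by their decreasing rearrangement; each group has total weight \<open>n!\<close> by \<open>card_permutations_tuple_weight\<close>.
\<close>

lemma sum_weakly_decreasing:
  fixes F :: "nat list \<Rightarrow> real"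
  assumes M: "finite M" and F: "\<And>ms ms'. length ms = n \<Longrightarrow> mset ms = mset ms' \<Longrightarrow> F ms = F ms'"
  shows "(\<Sum>ms\<in>tuples M n. tuple_weight 1 ms * F ms) = fact n * (\<Sum>ms\<in>{ms\<in>tuples M n. sorted_wrt (\<ge>) ms}. F ms)"
proof -
  let ?S = "{ms\<in>tuples M n. sorted_wrt (\<ge>) ms}"
  have fibre: "{ms\<in>tuples M n. rev (sort ms) = s} = permutations_of_multiset (mset s)" if s: "s \<in> ?S" for s
  proof (intro set_eqI iffI)
    fix ms assume "ms \<in> permutations_of_multiset (mset s)"
    hence m: "mset ms = mset s" by (simp add: permutations_of_multiset_def)
    have "sorted (rev s)" using s by (simp add: sorted_wrt_rev)
    hence "sort ms = rev s" using m by (intro properties_for_sort) auto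
    thus "ms \<in> {ms\<in>tuples M n. rev (sort ms) = s}"
      using s mset_eq_setD[OF m] mset_eq_length[OF m] by (auto simp: tuples_def)
  next
    fix ms assume "ms \<in> {ms\<in>tuples M n. rev (sort ms) = s}"
    hence "mset ms = mset s" by (metis (mono_tags, lifting) mem_Collect_eq mset_rev mset_sort)
    thus "ms \<in> permutations_of_multiset (mset s)" by (simp add: permutations_of_multiset_def)
  qed
  have "(\<Sum>ms\<in>tuples M n. tuple_weight 1 ms * F ms) = (\<Sum>s\<in>?S. \<Sum>ms\<in>{ms\<in>tuples M n. rev (sort ms) = s}. tuple_weight 1 ms * F ms)"
  proof (rule sum.group[symmetric])
    have "sorted_wrt (\<ge>) (rev (sort ms))" for ms :: "nat list"
      using sorted_sort[of ms] by (simp add: sorted_wrt_rev)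
    thus "(\<lambda>ms. rev (sort ms)) ` tuples M n \<subseteq> ?S" by (auto simp: tuples_def)
  qed (use M in \<open>auto simp: finite_tuples\<close>)
  also have "\<dots> = (\<Sum>s\<in>?S. fact n * F s)"
  proof (rule sum.cong[OF refl])
    fix s assume s: "s \<in> ?S"
    let ?P = "permutations_of_multiset (mset s)"
    have c: "card ?P \<noteq> 0"
      using card_permutations_tuple_weight[of s, where ?'r = real] by (intro notI) simp
    have "(\<Sum>ms\<in>{ms\<in>tuples M n. rev (sort ms) = s}. tuple_weight 1 ms * F ms) = (\<Sum>ms\<in>?P. fact n / real (card ?P) * F s)"
      unfolding fibre[OF s]
    proof (rule sum.cong[OF refl])
      fix ms assume "ms \<in> ?P"
      hence m: "mset ms = mset s" by (simp add: permutations_of_multiset_def)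
      hence len: "length ms = n" using s mset_eq_length[OF m] by (simp add: tuples_def)
      with card_permutations_tuple_weight[of ms, where ?'r = real] m c
      have "tuple_weight 1 ms = fact n / real (card ?P)" by (simp add: field_simps)
      thus "tuple_weight 1 ms * F ms = fact n / real (card ?P) * F s" using F[OF len m] by simp
    qed
    also have "\<dots> = fact n * F s" using c by simp
    finally show "(\<Sum>ms\<in>{ms\<in>tuples M n. rev (sort ms) = s}. tuple_weight 1 ms * F ms) = fact n * F s" .
  qed
  finally show ?thesis by (simp add: sum_distrib_left)
qed

lemma tuple_weight_distinct: "distinct ms \<Longrightarrow> tuple_weight e ms = 1"
  by (induction ms) (auto simp: count_mset_0_iff[THEN iffD2])

lemma tuple_weight_not_distinct: "\<not> distinct ms \<Longrightarrow> tuple_weight (- 1 :: 'r :: comm_ring_1) ms = 0"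
proof (induction ms)
  case (Cons x xs)
  show ?case
  proof (cases "distinct xs")
    case True
    hence "count (mset xs) x = 1"
      using Cons.prems by (simp add: distinct_count_atmost_1[THEN iffD1, rule_format])
    thus ?thesis by simp
  qed (use Cons in simp)
qed simp

text \<open>
  The case of \<open>sum_weakly_decreasing\<close> for the function that is cut off to tuples with distinct entries.
\<close>

lemma sum_strictly_decreasing:
  fixes F :: "nat list \<Rightarrow> real"
  assumes M: "finite M" and F: "\<And>ms ms'. length ms = n \<Longrightarrow> mset ms = mset ms' \<Longrightarrow> F ms = F ms'"
  shows "(\<Sum>ms\<in>tuples M n. tuple_weight (- 1) ms * F ms) = fact n * (\<Sum>ms\<in>{ms\<in>tuples M n. sorted_wrt (>) ms}. F ms)"
proof -
  have "tuple_weight (- 1) ms * F ms = tuple_weight 1 ms * (if distinct ms then F ms else 0)" for ms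
    by (auto simp: tuple_weight_distinct tuple_weight_not_distinct)
  hence "(\<Sum>ms\<in>tuples M n. tuple_weight (- 1) ms * F ms) = (\<Sum>ms\<in>tuples M n. tuple_weight 1 ms * (if distinct ms then F ms else 0))"
    by simp
  also have "\<dots> = fact n * (\<Sum>ms\<in>{ms\<in>tuples M n. sorted_wrt (\<ge>) ms}. if distinct ms then F ms else 0)"
    by (rule sum_weakly_decreasing[OF M]) (use F mset_eq_imp_distinct_iff in metis)
  also have "(\<Sum>ms\<in>{ms\<in>tuples M n. sorted_wrt (\<ge>) ms}. if distinct ms then F ms else 0) =
     (\<Sum>ms\<in>{ms\<in>tuples M n. sorted_wrt (\<ge>) ms} \<inter> {ms. distinct ms}. F ms)"
    using M by (subst sum.inter_restrict) (auto simp: finite_tuples)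
  also have "sorted_wrt (>) ms \<longleftrightarrow> sorted_wrt (\<ge>) ms \<and> distinct ms" for ms :: "nat list"
    by (induction ms) (auto simp: order.strict_iff_order)
  hence "{ms\<in>tuples M n. sorted_wrt (\<ge>) ms} \<inter> {ms. distinct ms} = {ms\<in>tuples M n. sorted_wrt (>) ms}"
    by auto
  finally show ?thesis .
qed

text \<open>The substitution \<open>X \<mapsto> X / m\<^sup>2\<close>.\<close>

definition rescale :: "nat \<Rightarrow> real fps \<Rightarrow> real fps" where
  "rescale m u = Abs_fps (\<lambda>k. u $ k / real m ^ (2 * k))"

lemma rescale_nth [simp]: "rescale m u $ k = u $ k / real m ^ (2 * k)"
  by (simp add: rescale_def)

lemma rescale_mult: "rescale m (u * v) = rescale m u * rescale m v"
proof (rule fps_ext)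
  fix k
  have "u $ i * v $ (k - i) / real m ^ (2 * k) =
     (u $ i / real m ^ (2 * i)) * (v $ (k - i) / real m ^ (2 * (k - i)))" if "i \<in> {0..k}" for i
  proof -
    have "2 * k = 2 * i + 2 * (k - i)" using that by simp
    hence "real m ^ (2 * k) = real m ^ (2 * i) * real m ^ (2 * (k - i))" by (metis power_add)
    thus ?thesis by simp
  qed
  thus "rescale m (u * v) $ k = (rescale m u * rescale m v) $ k"
    unfolding rescale_nth fps_mult_nth sum_divide_distrib by (rule sum.cong[OF refl])
qed

definition odds :: "nat \<Rightarrow> nat set" where
  "odds N = (\<lambda>b. 2 * b + 1) ` {..<N}"

lemma finite_odds [simp]: "finite (odds N)"
  by (simp add: odds_def)

lemma sum_odds: "(\<Sum>m\<in>odds N. f m) = (\<Sum>b<N. f (2 * b + 1))"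
  unfolding odds_def by (subst sum.reindex) (auto simp: inj_on_def)

lemma fps_mult_tendsto:
  fixes A B :: "nat \<Rightarrow> real fps"
  assumes "\<And>k. (\<lambda>N. A N $ k) \<longlonglongrightarrow> a $ k" "\<And>k. (\<lambda>N. B N $ k) \<longlonglongrightarrow> b $ k"
  shows "(\<lambda>N. (A N * B N) $ k) \<longlonglongrightarrow> (a * b) $ k"
  unfolding fps_mult_nth by (intro tendsto_intros assms)

text \<open>
  Induction on the number of factors by \<open>tuple_sum_Cons\<close>. Working with truncations \<open>m < 2N\<close> keeps all sums over
  tuples finite; only the single series \<open>\<Sum>\<^sub>m u(X/m\<^sup>2)\<close> has to converge, and it does so coefficientwise. When two
  factors are multiplied, their degrees add up, so the weight is preserved.
\<close>

lemma tuple_sum_limit: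
  assumes "length ds = length us"
    and "\<And>i. i < length us \<Longrightarrow> us ! i \<in> rat_span (geo_basis (ds ! i)) \<and> ds ! i \<ge> 1"
  shows "\<exists>F \<in> rat_span (power_basis (length us) (sum_list ds)).
    \<forall>k. (\<lambda>N. tuple_sum (rat_fps e) (odds N) (map (\<lambda>u m. rescale m u) us) $ k) \<longlonglongrightarrow> F $ k"
  using assms
proof (induction "length us" arbitrary: us ds)
  case 0
  have "1 \<in> power_basis 0 0" by (force simp: power_basis_def)
  thus ?case using 0 by (intro bexI[of _ 1]) (auto intro: rat_span.base)
next
  case (Suc n)
  from Suc obtain u us' d ds' where us: "us = u # us'" "length us' = n" and ds: "ds = d # ds'" "length ds' = n"
    by (metis length_Suc_conv)
  have u: "u \<in> rat_span (geo_basis d)" "d \<ge> 1" using Suc.prems(2)[of 0] us ds by auto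
  have us': "us' ! i \<in> rat_span (geo_basis (ds' ! i)) \<and> ds' ! i \<ge> 1" if "i < n" for i
    using Suc.prems(2)[of "Suc i"] us ds that by auto
  have nds: "n \<le> sum_list ds'"
  proof -
    have "(\<Sum>i<n. 1) \<le> (\<Sum>i<n. ds' ! i)" using us' by (intro sum_mono) auto
    thus ?thesis using ds by (simp add: sum_list_sum_nth atLeast0LessThan)
  qed
  let ?L = "\<lambda>us N. tuple_sum (rat_fps e) (odds N) (map (\<lambda>u m. rescale m u) us)"
  obtain F0 where F0: "F0 \<in> rat_span (power_basis n (sum_list ds'))" "\<And>k. (\<lambda>N. ?L us' N $ k) \<longlonglongrightarrow> F0 $ k"
    using Suc.hyps(1)[of us' ds'] us ds us' by auto
  have "\<exists>F\<in>rat_span (power_basis n (sum_list ds' + d)). \<forall>k. (\<lambda>N. ?L (us'[j := us' ! j * u]) N $ k) \<longlonglongrightarrow> F $ k"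
    if j: "j < n" for j
  proof -
    have "sum_list (ds'[j := ds' ! j + d]) = sum_list ds' + d"
      using j ds by (simp add: sum_list_update)
    moreover have "us'[j := us' ! j * u] ! i \<in> rat_span (geo_basis (ds'[j := ds' ! j + d] ! i)) \<and> ds'[j := ds' ! j + d] ! i \<ge> 1"
      if "i < n" for i
      using us'[OF that] geo_mult[of "us' ! j" "ds' ! j" u d] u us'[OF j] j us ds that
      by (auto simp: nth_list_update)
    ultimately show ?thesis
      using Suc.hyps(1)[of "us'[j := us' ! j * u]" "ds'[j := ds' ! j + d]"] us ds by auto
  qed
  then obtain Fj where Fj: "\<And>j. j < n \<Longrightarrow> Fj j \<in> rat_span (power_basis n (sum_list ds' + d))"
      "\<And>j k. j < n \<Longrightarrow> (\<lambda>N. ?L (us'[j := us' ! j * u]) N $ k) \<longlonglongrightarrow> Fj j $ k"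
    by metis
  have Z: "(\<lambda>N. (\<Sum>m\<in>odds N. rescale m u) $ k) \<longlonglongrightarrow> t_hadamard u $ k" for k
  proof (cases "k = 0")
    case True
    thus ?thesis using geo_nth_0[OF u(1)] by (simp add: fps_sum_nth t_hadamard_def)
  next
    case False
    have "(\<lambda>N. u $ k * (\<Sum>b<N. 1 / real (2 * b + 1) ^ (2 * k))) \<longlonglongrightarrow> u $ k * t_even k"
      using False by (intro tendsto_intros t_even_LIMSEQ) simp
    thus ?thesis by (simp add: fps_sum_nth sum_odds t_hadamard_def sum_distrib_left)
  qed
  have rec: "?L us N = (\<Sum>m\<in>odds N. rescale m u) * ?L us' N + rat_fps e * (\<Sum>j<n. ?L (us'[j := us' ! j * u]) N)" for N
  proof -
    have "(map (\<lambda>u m. rescale m u) us')[j := (\<lambda>x. (map (\<lambda>u m. rescale m u) us' ! j) x * rescale x u)] =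
        map (\<lambda>u m. rescale m u) (us'[j := us' ! j * u])" if "j < n" for j
      using that us by (simp add: map_update rescale_mult)
    thus ?thesis using us by (simp add: tuple_sum_Cons)
  qed
  define F where "F = t_hadamard u * F0 + rat_fps e * (\<Sum>j<n. Fj j)"
  have lim: "(\<lambda>N. ?L us N $ k) \<longlonglongrightarrow> F $ k" for k
    unfolding rec F_def fps_add_nth rat_fps_nth fps_sum_nth
    by (intro tendsto_intros fps_mult_tendsto Z F0 Fj(2)) auto
  have mem: "F \<in> rat_span (power_basis (Suc n) (d + sum_list ds'))"
    unfolding F_def
  proof (intro rat_span.add rat_span.scale rat_span_sum)
    show "t_hadamard u * F0 \<in> rat_span (power_basis (Suc n) (d + sum_list ds'))"
      by (rule linear_mult_power[OF t_hadamard_geo[OF u] F0(1) nds u(2)])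
    show "Fj j \<in> rat_span (power_basis (Suc n) (d + sum_list ds'))" if "j \<in> {..<n}" for j
      by (rule power_mono_basis[OF _ _ Fj(1)]) (use that in auto)
  qed
  have "length us = Suc n" "sum_list ds = d + sum_list ds'" using us ds by simp_all
  thus ?case using lim mem by metis
qed

section \<open>Multiple t-values and symmetric polynomials\<close>

text \<open>
  For nonnegative terms with bounded partial sums, an unordered sum is the limit along any exhaustion.
\<close>

lemma LIMSEQ_sum_exhaustion:
  fixes f :: "'b \<Rightarrow> real"
  assumes fin: "\<And>N. finite (A N)" and mono: "\<And>N N'. N \<le> N' \<Longrightarrow> A N \<subseteq> A N'"
    and nonneg: "\<And>x. f x \<ge> 0" and bound: "\<And>N. sum f (A N) \<le> C"
  shows "(\<lambda>N. sum f (A N)) \<longlonglongrightarrow> infsum f (\<Union>N. A N)"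
proof -
  have ev: "\<exists>N0. \<forall>N\<ge>N0. X \<subseteq> A N" if X: "finite X" "X \<subseteq> (\<Union>N. A N)" for X
    using X
  proof (induction X)
    case (insert x X)
    then obtain N0 N1 where "\<forall>N\<ge>N0. X \<subseteq> A N" "x \<in> A N1" by auto
    hence "\<forall>N\<ge>max N0 N1. insert x X \<subseteq> A N" using mono by (meson insert_subset max.boundedE subsetD)
    thus ?case by blast
  qed simp
  have "bdd_above (sum f ` {F. F \<subseteq> (\<Union>N. A N) \<and> finite F})"
  proof (rule bdd_aboveI2)
    fix X assume "X \<in> {F. F \<subseteq> (\<Union>N. A N) \<and> finite F}"
    then obtain N where "X \<subseteq> A N" using ev[of X] by blast
    hence "sum f X \<le> sum f (A N)" using fin nonneg by (intro sum_mono2) auto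
    with bound[of N] show "sum f X \<le> C" by linarith
  qed
  hence "f summable_on (\<Union>N. A N)" using nonneg by (intro nonneg_bdd_above_summable_on) auto
  hence "(sum f \<longlongrightarrow> infsum f (\<Union>N. A N)) (finite_subsets_at_top (\<Union>N. A N))"
    using has_sum_infsum has_sum_def by blast
  moreover have "filterlim A (finite_subsets_at_top (\<Union>N. A N)) sequentially"
    unfolding filterlim_finite_subsets_at_top
  proof (intro allI impI)
    fix X assume "finite X \<and> X \<subseteq> (\<Union>N. A N)"
    then obtain N0 where "\<And>N. N \<ge> N0 \<Longrightarrow> X \<subseteq> A N" using ev[of X] by metis
    thus "\<forall>\<^sub>F N in sequentially. finite (A N) \<and> X \<subseteq> A N \<and> A N \<subseteq> (\<Union>N. A N)"
      using fin by (intro eventually_sequentiallyI[of N0]) auto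
  qed
  ultimately show ?thesis by (rule filterlim_compose)
qed

text \<open>The term of \<open>t(2k\<^sub>1, \<dots>, 2k\<^sub>n)\<close>; only its range of summation distinguishes \<open>t\<close> from \<open>t\<^sup>\<star>\<close>.\<close>

definition inverse_monomial :: "nat list \<Rightarrow> nat list \<Rightarrow> real" where
  "inverse_monomial ks ms = (\<Prod>i<length ks. 1 / real (ms ! i) ^ (2 * (ks ! i)))"

lemma odds_iff: "m \<in> odds N \<longleftrightarrow> odd m \<and> m < 2 * N"
  by (auto simp: odds_def image_iff elim!: oddE)

lemma Union_tuples_odds:
  "(\<Union>N. {ms \<in> tuples (odds N) n. sorted_wrt R ms}) =
     {ms. length ms = n \<and> sorted_wrt R ms \<and> (\<forall>m\<in>set ms. odd m)}"
proof (intro equalityI subsetI)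
  fix ms assume ms: "ms \<in> {ms. length ms = n \<and> sorted_wrt R ms \<and> (\<forall>m\<in>set ms. odd m)}"
  have "m < 2 * Suc (sum_list ms)" if "m \<in> set ms" for m
    using member_le_sum_list[OF that] by simp
  hence "ms \<in> {ms \<in> tuples (odds (Suc (sum_list ms))) n. sorted_wrt R ms}"
    using ms by (auto simp: tuples_def odds_iff)
  thus "ms \<in> (\<Union>N. {ms \<in> tuples (odds N) n. sorted_wrt R ms})" by blast
qed (auto simp: tuples_def odds_iff)

text \<open>
  The partial sums are bounded by the product of the \<open>t(2k\<^sub>i)\<close>, which is the sum over all tuples, ordered or not.
\<close>

lemma sum_inverse_monomial_LIMSEQ:
  assumes "\<And>j. j \<in> set ks \<Longrightarrow> j \<ge> 1"
  shows "(\<lambda>N. \<Sum>ms\<in>{ms \<in> tuples (odds N) (length ks). sorted_wrt R ms}. inverse_monomial ks ms)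
     \<longlonglongrightarrow> infsum (inverse_monomial ks) {ms. length ms = length ks \<and> sorted_wrt R ms \<and> (\<forall>m\<in>set ms. odd m)}"
  unfolding Union_tuples_odds[symmetric]
proof (rule LIMSEQ_sum_exhaustion)
  show nonneg: "inverse_monomial ks ms \<ge> 0" for ms by (auto simp: inverse_monomial_def intro!: prod_nonneg)
  fix N
  show "finite {ms \<in> tuples (odds N) (length ks). sorted_wrt R ms}" by (simp add: finite_tuples)
  have "(\<Sum>ms\<in>{ms \<in> tuples (odds N) (length ks). sorted_wrt R ms}. inverse_monomial ks ms)
      \<le> (\<Sum>ms\<in>tuples (odds N) (length ks). inverse_monomial ks ms)"
    by (intro sum_mono2 nonneg) (auto simp: finite_tuples)
  also have "\<dots> = (\<Prod>i<length ks. \<Sum>m\<in>odds N. 1 / real m ^ (2 * (ks ! i)))"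
    unfolding inverse_monomial_def by (rule sum_tuples_prod) simp
  also have "\<dots> \<le> (\<Prod>i<length ks. t_even (ks ! i))"
    unfolding sum_odds using assms by (intro prod_mono conjI sum_nonneg sum_le_t_even) auto
  finally show "(\<Sum>ms\<in>{ms \<in> tuples (odds N) (length ks). sorted_wrt R ms}. inverse_monomial ks ms)
      \<le> (\<Prod>i<length ks. t_even (ks ! i))" .
next
  fix N N' :: nat assume "N \<le> N'"
  thus "{ms \<in> tuples (odds N) (length ks). sorted_wrt R ms} \<subseteq> {ms \<in> tuples (odds N') (length ks). sorted_wrt R ms}"
    by (auto simp: tuples_def odds_def)
qed

lemma mtv_eq_infsum:
  "mtv (map (\<lambda>j. 2 * j) ks) =
     infsum (inverse_monomial ks) {ms. length ms = length ks \<and> sorted_wrt (>) ms \<and> (\<forall>m\<in>set ms. odd m)}"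
  unfolding mtv_def
  by (rule infsum_cong_neutral) (auto simp: inverse_monomial_def prod_dividef intro: odd_pos)

lemma mtv_star_eq_infsum:
  "mtv_star (map (\<lambda>j. 2 * j) ks) =
     infsum (inverse_monomial ks) {ms. length ms = length ks \<and> sorted_wrt (\<ge>) ms \<and> (\<forall>m\<in>set ms. odd m)}"
  unfolding mtv_star_def
  by (rule infsum_cong_neutral) (auto simp: inverse_monomial_def prod_dividef Suc_le_eq intro: odd_pos)

lemma tval_eq_t_even: "tval (2 * k) = t_even k"
proof (cases "k = 0")
  case False
  have "{ms \<in> tuples (odds N) 1. sorted_wrt (>) ms} = tuples (odds N) 1" for N
    by (auto simp: tuples_def length_Suc_conv)
  hence "(\<Sum>ms\<in>{ms \<in> tuples (odds N) (length [k]). sorted_wrt (>) ms}. inverse_monomial [k] ms) =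
      (\<Sum>b<N. 1 / real (2 * b + 1) ^ (2 * k))" for N
    using sum_tuples_prod[of "odds N" "\<lambda>_ m. 1 / real m ^ (2 * k)" 1]
    by (simp add: inverse_monomial_def sum_odds)
  moreover have "(\<lambda>N. \<Sum>ms\<in>{ms \<in> tuples (odds N) (length [k]). sorted_wrt (>) ms}. inverse_monomial [k] ms) \<longlonglongrightarrow> mtv [2 * k]"
    using sum_inverse_monomial_LIMSEQ[of "[k]" "(>)"] mtv_eq_infsum[of "[k]"] False by simp
  ultimately have "(\<lambda>N. \<Sum>b<N. 1 / real (2 * b + 1) ^ (2 * k)) \<longlonglongrightarrow> mtv [2 * k]" by simp
  with t_even_LIMSEQ[of k] False have "mtv [2 * k] = t_even k" by (intro LIMSEQ_unique) auto
  thus ?thesis using False by (simp add: tval_def)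
qed (simp add: tval_def)

lemma finite_compositions: "finite (compositions n k)"
proof (rule finite_subset)
  show "compositions n k \<subseteq> {ks. set ks \<subseteq> {..k} \<and> length ks = n}"
    using member_le_sum_list by (fastforce simp: compositions_def)
qed (rule finite_lists_length_eq, simp)

text \<open>Vanishing constant terms make compositions, with positive parts, suffice as exponents.\<close>

lemma fps_prod_nth_compositions:
  fixes F :: "nat \<Rightarrow> real fps"
  assumes "\<And>i. i < n \<Longrightarrow> F i $ 0 = 0"
  shows "(\<Prod>i<n. F i) $ k = (\<Sum>ks\<in>compositions n k. \<Prod>i<n. F i $ (ks ! i))"
  using assms
proof (induction n arbitrary: F k)
  case 0
  have "compositions 0 k = (if k = 0 then {[]} else {})" by (auto simp: compositions_def)
  thus ?case by simp
next
  case (Suc n)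
  have "(\<Prod>i<Suc n. F i) $ k = (\<Sum>a=0..k. F 0 $ a * (\<Prod>i<n. F (Suc i)) $ (k - a))"
    by (simp add: prod.lessThan_Suc_shift fps_mult_nth del: prod.lessThan_Suc)
  also have "\<dots> = (\<Sum>a=1..k. F 0 $ a * (\<Prod>i<n. F (Suc i)) $ (k - a))"
    using Suc.prems[of 0] by (intro sum.mono_neutral_right) (auto simp: not_le Suc_le_eq)
  also have "\<dots> = (\<Sum>a=1..k. \<Sum>ks\<in>compositions n (k - a). F 0 $ a * (\<Prod>i<n. F (Suc i) $ (ks ! i)))"
    using Suc.IH[of "\<lambda>i. F (Suc i)"] Suc.prems by (simp add: sum_distrib_left)
  also have "\<dots> = (\<Sum>(a, ks)\<in>(SIGMA a:{1..k}. compositions n (k - a)). F 0 $ a * (\<Prod>i<n. F (Suc i) $ (ks ! i)))"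
    by (rule sum.Sigma) (auto simp: finite_compositions)
  also have "\<dots> = (\<Sum>ks\<in>compositions (Suc n) k. \<Prod>i<Suc n. F i $ (ks ! i))"
    by (rule sum.reindex_bij_witness[of _ "\<lambda>ks. (hd ks, tl ks)" "\<lambda>(a, ks). a # ks"])
       (auto simp: compositions_def length_Suc_conv prod.lessThan_Suc_shift simp del: prod.lessThan_Suc)
  finally show ?case .
qed

lemma tuple_weight_rat_fps: "tuple_weight (rat_fps e) ms = fps_const (tuple_weight (of_rat e) ms)"
  by (induction ms) (simp_all add: rat_fps_def fps_const_mult[symmetric] fps_const_add[symmetric] fps_of_nat[symmetric]
        del: fps_const_mult fps_const_add)

text \<open>
  The tuple sum of the series \<open>pow_fps\<close> is the generating function for a monomial with exponents \<open>as\<close>.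
\<close>

lemma tuple_sum_pow_nth:
  assumes "length as = n"
  shows "tuple_sum (rat_fps e) M (map (\<lambda>u m. rescale m u) (map pow_fps as)) $ k =
    (\<Sum>ms\<in>tuples M n. tuple_weight (of_rat e) ms *
      (\<Sum>ks\<in>compositions n k. (\<Prod>i<n. real (ks ! i) ^ (as ! i)) * inverse_monomial ks ms))"
proof -
  have "(\<Prod>i<n. rescale (ms ! i) (pow_fps (as ! i))) $ k =
     (\<Sum>ks\<in>compositions n k. (\<Prod>i<n. real (ks ! i) ^ (as ! i)) * inverse_monomial ks ms)" for ms
  proof -
    have "(\<Prod>i<n. rescale (ms ! i) (pow_fps (as ! i))) $ k =
       (\<Sum>ks\<in>compositions n k. \<Prod>i<n. rescale (ms ! i) (pow_fps (as ! i)) $ (ks ! i))"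
      by (rule fps_prod_nth_compositions) (simp add: pow_fps_nth)
    also have "\<dots> = (\<Sum>ks\<in>compositions n k. (\<Prod>i<n. real (ks ! i) ^ (as ! i)) * inverse_monomial ks ms)"
    proof (intro sum.cong refl)
      fix ks assume ks: "ks \<in> compositions n k"
      have "(\<Prod>i<n. rescale (ms ! i) (pow_fps (as ! i)) $ (ks ! i)) =
         (\<Prod>i<n. real (ks ! i) ^ (as ! i) * (1 / real (ms ! i) ^ (2 * (ks ! i))))"
      proof (intro prod.cong refl)
        fix i assume "i \<in> {..<n}"
        hence "ks ! i \<in> set ks" using ks by (auto simp: compositions_def)
        hence "ks ! i \<noteq> 0" using ks by (force simp: compositions_def)
        thus "rescale (ms ! i) (pow_fps (as ! i)) $ (ks ! i) = real (ks ! i) ^ (as ! i) * (1 / real (ms ! i) ^ (2 * (ks ! i)))"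
          by (simp add: pow_fps_nth)
      qed
      thus "(\<Prod>i<n. rescale (ms ! i) (pow_fps (as ! i)) $ (ks ! i)) =
         (\<Prod>i<n. real (ks ! i) ^ (as ! i)) * inverse_monomial ks ms"
        using ks by (simp only: prod.distrib inverse_monomial_def) (simp add: compositions_def)
    qed
    finally show ?thesis .
  qed
  thus ?thesis using assms
    by (simp add: tuple_sum_def tuple_weight_rat_fps fps_sum_nth)
qed

lemma mpoly_eval_vars:
  fixes f :: "'r::comm_semiring_1 mpoly"
  assumes "mpoly_vars f \<subseteq> {..<n}"
  shows "mpoly_eval x f = (\<Sum>m\<in>Poly_Mapping.keys f. Poly_Mapping.lookup f m *
            (\<Prod>i<n. x i ^ Poly_Mapping.lookup m i))"
  unfolding mpoly_eval_def
proof (rule sum.cong[OF refl])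
  fix m assume "m \<in> Poly_Mapping.keys f"
  hence "Poly_Mapping.keys m \<subseteq> {..<n}" using assms by (auto simp: mpoly_vars_def)
  hence "(\<Prod>i\<in>Poly_Mapping.keys m. x i ^ Poly_Mapping.lookup m i) = (\<Prod>i<n. x i ^ Poly_Mapping.lookup m i)"
    by (intro prod.mono_neutral_left) (auto simp: in_keys_iff)
  thus "Poly_Mapping.lookup f m * (\<Prod>i\<in>Poly_Mapping.keys m. x i ^ Poly_Mapping.lookup m i) =
      Poly_Mapping.lookup f m * (\<Prod>i<n. x i ^ Poly_Mapping.lookup m i)" by simp
qed

text \<open>
  Renaming the variables of a monomial by \<open>p\<close> permutes its exponents by the inverse of \<open>p\<close>, and symmetric
  polynomials have the same coefficient at both monomials.
\<close>

lemma mpoly_eval_symmetric: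
  fixes f :: "'r::comm_semiring_1 mpoly"
  assumes vars: "mpoly_vars f \<subseteq> {..<n}" and sym: "symmetric_mpoly n f" and p: "p permutes {..<n}"
  shows "mpoly_eval (\<lambda>i. x (p i)) f = mpoly_eval x f"
proof -
  have inv: "inv p permutes {..<n}" using p by (rule permutes_inv)
  have lk: "Poly_Mapping.lookup f (Poly_Mapping.map_key q m) = Poly_Mapping.lookup f m" if "q permutes {..<n}" for q m
    using sym that by (auto simp: symmetric_mpoly_def)
  have keys: "Poly_Mapping.map_key q m \<in> Poly_Mapping.keys f" if "q permutes {..<n}" "m \<in> Poly_Mapping.keys f" for q m
    using that lk by (simp add: in_keys_iff)
  have lkm: "Poly_Mapping.lookup (Poly_Mapping.map_key q m) i = Poly_Mapping.lookup m (q i)"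
    if "q permutes {..<n}" for q i and m :: "nat \<Rightarrow>\<^sub>0 nat"
    using permutes_inj[OF that] by (simp add: map_key.rep_eq)
  have cancel: "Poly_Mapping.map_key q (Poly_Mapping.map_key q' m) = m"
    if "q permutes {..<n}" "q' permutes {..<n}" "\<And>i. q' (q i) = i" for q q' and m :: "nat \<Rightarrow>\<^sub>0 nat"
    by (rule poly_mapping_eqI) (simp add: lkm that)
  show ?thesis unfolding mpoly_eval_vars[OF vars]
  proof (rule sum.reindex_bij_witness[of _ "Poly_Mapping.map_key p" "Poly_Mapping.map_key (inv p)"])
    fix m assume m: "m \<in> Poly_Mapping.keys f"
    show "Poly_Mapping.map_key p (Poly_Mapping.map_key (inv p) m) = m"
         "Poly_Mapping.map_key (inv p) (Poly_Mapping.map_key p m) = m"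
      using p inv permutes_inverses[OF p] by (intro cancel; simp)+
    show "Poly_Mapping.map_key p m \<in> Poly_Mapping.keys f" "Poly_Mapping.map_key (inv p) m \<in> Poly_Mapping.keys f"
      using keys p inv m by auto
    have "(\<Prod>i<n. x i ^ Poly_Mapping.lookup (Poly_Mapping.map_key (inv p) m) i) =
        (\<Prod>i<n. x (p i) ^ Poly_Mapping.lookup (Poly_Mapping.map_key (inv p) m) (p i))"
      using prod.permute[OF p, of "\<lambda>i. x i ^ Poly_Mapping.lookup (Poly_Mapping.map_key (inv p) m) i"]
      by (simp add: o_def)
    also have "\<dots> = (\<Prod>i<n. x (p i) ^ Poly_Mapping.lookup m i)"
      by (simp add: lkm[OF inv] permutes_inverses[OF p])
    finally show "Poly_Mapping.lookup f (Poly_Mapping.map_key (inv p) m) *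
         (\<Prod>i<n. x i ^ Poly_Mapping.lookup (Poly_Mapping.map_key (inv p) m) i) =
       Poly_Mapping.lookup f m * (\<Prod>i<n. x (p i) ^ Poly_Mapping.lookup m i)"
      by (simp add: lk[OF inv])
  qed
qed

lemma permute_list_compositions:
  assumes "p permutes {..<n}" "ks \<in> compositions n k"
  shows "permute_list p ks \<in> compositions n k"
proof -
  have "mset (permute_list p ks) = mset ks" using assms by (intro mset_permute_list) (auto simp: compositions_def)
  hence "set (permute_list p ks) = set ks" "sum_list (permute_list p ks) = sum_list ks"
    by (metis mset_eq_setD) (metis \<open>mset (permute_list p ks) = mset ks\<close> sum_mset_sum_list)
  thus ?thesis using assms(2) by (simp add: compositions_def)
qed

text \<open>A reordering of \<open>ms\<close> can be undone by the same reordering of the exponents, to which \<open>g\<close> is blind.\<close>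

lemma symmetric_sum_mset_invariant:
  fixes g :: "nat list \<Rightarrow> real"
  assumes g: "\<And>p ks. p permutes {..<n} \<Longrightarrow> ks \<in> compositions n k \<Longrightarrow> g (permute_list p ks) = g ks"
    and len: "length ms = n" and m: "mset ms = mset ms'"
  shows "(\<Sum>ks\<in>compositions n k. g ks * inverse_monomial ks ms) = (\<Sum>ks\<in>compositions n k. g ks * inverse_monomial ks ms')"
proof -
  have len': "length ms' = n" using len mset_eq_length[OF m] by simp
  obtain p where p: "p permutes {..<n}" "permute_list p ms' = ms"
    using mset_eq_permutation[OF m] len' by auto
  have inv: "inv p permutes {..<n}" using p(1) by (rule permutes_inv)
  have cl: "length ks = n" if "ks \<in> compositions n k" for ks using that by (simp add: compositions_def)
  show ?thesis
  proof (rule sum.reindex_bij_witness[of _ "permute_list p" "permute_list (inv p)"])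
    fix ks assume ks: "ks \<in> compositions n k"
    show "permute_list p (permute_list (inv p) ks) = ks"
      using permute_list_compose[of p ks "inv p"] p inv cl[OF ks] by (simp add: permutes_inv_o)
    show "permute_list (inv p) (permute_list p ks) = ks"
      using permute_list_compose[of "inv p" ks p] p inv cl[OF ks] by (simp add: permutes_inv_o)
    show "permute_list p ks \<in> compositions n k" "permute_list (inv p) ks \<in> compositions n k"
      using permute_list_compositions p inv ks by auto
    have "inverse_monomial (permute_list (inv p) ks) ms' = (\<Prod>i<n. 1 / real (ms' ! i) ^ (2 * (ks ! inv p i)))"
      using cl[OF ks] inv by (simp add: inverse_monomial_def permute_list_nth)
    also have "\<dots> = (\<Prod>i<n. 1 / real (ms' ! p i) ^ (2 * (ks ! inv p (p i))))"
      using prod.permute[OF p(1), of "\<lambda>i. 1 / real (ms' ! i) ^ (2 * (ks ! inv p i))"] by (simp add: o_def)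
    also have "\<dots> = inverse_monomial ks ms"
      using cl[OF ks] p len' by (auto simp: inverse_monomial_def permutes_inverses[OF p(1)] permute_list_nth simp flip: p(2))
    finally show "g (permute_list (inv p) ks) * inverse_monomial (permute_list (inv p) ks) ms' = g ks * inverse_monomial ks ms"
      using g[OF inv ks] by simp
  qed
qed

text \<open>
  The generating function of the weighted sums, for \<open>t\<close> and \<open>t\<^sup>\<star>\<close> at once. Only the whole polynomial is symmetric, so the
  averaging over all orders is applied to \<open>f\<close>, and \<open>f\<close> is split into monomials afterwards. A monomial with
  exponents \<open>a\<^sub>1, \<dots>, a\<^sub>n\<close> has weight \<open>(a\<^sub>1 + 1) + \<dots> + (a\<^sub>n + 1)\<close>, at most the degree of \<open>f\<close> plus \<open>n\<close>.
\<close>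

lemma weighted_sum_in_power_span:
  fixes f :: "rat mpoly" and e :: rat and tv :: "nat list \<Rightarrow> real"
  assumes vars: "mpoly_vars f \<subseteq> {..<n}" and sym: "symmetric_mpoly n f"
    and averaging: "\<And>(M :: nat set) (F :: nat list \<Rightarrow> real). finite M \<Longrightarrow> (\<And>ms ms'. length ms = n \<Longrightarrow> mset ms = mset ms' \<Longrightarrow> F ms = F ms') \<Longrightarrow>
      (\<Sum>ms\<in>tuples M n. tuple_weight (of_rat e) ms * F ms) = fact n * (\<Sum>ms\<in>{ms\<in>tuples M n. sorted_wrt R ms}. F ms)"
    and tv: "\<And>ks k. ks \<in> compositions n k \<Longrightarrow>
      (\<lambda>N. \<Sum>ms\<in>{ms\<in>tuples (odds N) n. sorted_wrt R ms}. inverse_monomial ks ms) \<longlonglongrightarrow> tv ks"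
  shows "\<exists>F \<in> rat_span (power_basis n (mpoly_degree f + n)). \<forall>k. F $ k =
    (\<Sum>ks\<in>compositions n k. of_rat (mpoly_eval (\<lambda>i. of_nat (ks ! i)) f) * tv ks)"
proof -
  define S where "S = Poly_Mapping.keys f"
  define ex where "ex m = map (Poly_Mapping.lookup m) [0..<n]" for m :: "nat \<Rightarrow>\<^sub>0 nat"
  define L where "L m N = tuple_sum (rat_fps e) (odds N) (map (\<lambda>u m. rescale m u) (map pow_fps (ex m)))" for m N
  define g where "g ks = (of_rat (mpoly_eval (\<lambda>i. of_nat (ks ! i)) f) :: real)" for ks :: "nat list"
  have S: "finite S" by (simp add: S_def)
  have deg: "sum_list (ex m) \<le> mpoly_degree f" if "m \<in> S" for m
  proof -
    have k: "Poly_Mapping.keys m \<subseteq> {..<n}" using that vars by (auto simp: mpoly_vars_def S_def)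
    have "sum_list (ex m) = (\<Sum>i<n. Poly_Mapping.lookup m i)"
      by (simp add: ex_def sum_list_sum_nth atLeast0LessThan)
    also have "\<dots> = (\<Sum>i\<in>Poly_Mapping.keys m. Poly_Mapping.lookup m i)"
      using k by (intro sum.mono_neutral_right) (auto simp: in_keys_iff)
    also have "\<dots> \<le> mpoly_degree f" unfolding mpoly_degree_def
      using that by (intro Max_ge) (auto simp: S_def)
    finally show ?thesis .
  qed
  have "\<exists>F\<in>rat_span (power_basis n (mpoly_degree f + n)). \<forall>k. (\<lambda>N. L m N $ k) \<longlonglongrightarrow> F $ k" if m: "m \<in> S" for m
  proof -
    have "sum_list (map Suc xs) = sum_list xs + length xs" for xs :: "nat list" by (induction xs) auto
    from this[of "ex m"] have sl: "sum_list (map Suc (ex m)) \<le> mpoly_degree f + n"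
      using deg[OF m] by (simp only:) (simp add: ex_def)
    obtain F where F: "F\<in>rat_span (power_basis (length (map pow_fps (ex m))) (sum_list (map Suc (ex m))))"
       "\<forall>k. (\<lambda>N. L m N $ k) \<longlonglongrightarrow> F $ k"
      using tuple_sum_limit[of "map Suc (ex m)" "map pow_fps (ex m)" e] unfolding L_def
      by (auto simp: pow_fps_geo)
    have "F \<in> rat_span (power_basis n (mpoly_degree f + n))"
      by (rule power_mono_basis[OF sl _ F(1)]) (simp add: ex_def)
    with F(2) show ?thesis by blast
  qed
  then obtain Fm where Fm: "\<And>m. m \<in> S \<Longrightarrow> Fm m \<in> rat_span (power_basis n (mpoly_degree f + n))"
      "\<And>m k. m \<in> S \<Longrightarrow> (\<lambda>N. L m N $ k) \<longlonglongrightarrow> Fm m $ k" by metis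
  \<comment> \<open>The sum over all tuples counts every ordered tuple \<open>n!\<close> times.\<close>
  define F where "F = rat_fps (1 / fact n) * (\<Sum>m\<in>S. rat_fps (Poly_Mapping.lookup f m) * Fm m)"
  have FC: "F \<in> rat_span (power_basis n (mpoly_degree f + n))"
    unfolding F_def by (intro rat_span.scale rat_span_sum Fm)
  have Fk: "F $ k = (\<Sum>ks\<in>compositions n k. g ks * tv ks)" for k
  proof -
    have lim1: "(\<lambda>N. 1 / fact n * (\<Sum>m\<in>S. of_rat (Poly_Mapping.lookup f m) * L m N $ k)) \<longlonglongrightarrow> F $ k"
    proof -
      have "of_rat (fact n) = (fact n :: real)"
        using of_rat_of_nat_eq[of "fact n", where ?'a = real] unfolding of_nat_fact .
      hence fact: "of_rat (1 / fact n) = (1 / fact n :: real)"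
        by (simp only: of_rat_divide of_rat_1)
      show ?thesis unfolding F_def rat_fps_nth fps_sum_nth fact
        by (intro tendsto_mult tendsto_const tendsto_sum Fm(2))
    qed
    have g_eq: "g ks = (\<Sum>m\<in>S. of_rat (Poly_Mapping.lookup f m) * (\<Prod>i<n. real (ks ! i) ^ (ex m ! i)))" for ks
      unfolding g_def mpoly_eval_vars[OF vars] S_def
      by (simp add: of_rat_sum of_rat_mult of_rat_prod of_rat_power ex_def)
    have g_perm: "g (permute_list p ks) = g ks" if p: "p permutes {..<n}" and ks: "ks \<in> compositions n k" for p ks
    proof -
      have "length ks = n" using ks by (simp add: compositions_def)
      hence "mpoly_eval (\<lambda>i. of_nat (permute_list p ks ! i)) f = mpoly_eval (\<lambda>i. of_nat (ks ! p i)) f"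
        using p unfolding mpoly_eval_vars[OF vars]
        by (intro sum.cong refl arg_cong2[of _ _ _ _ "(*)"] prod.cong) (simp add: permute_list_nth)
      also have "\<dots> = mpoly_eval (\<lambda>i. of_nat (ks ! i)) f"
        by (rule mpoly_eval_symmetric[OF vars sym p])
      finally show ?thesis by (simp add: g_def)
    qed
    have "1 / fact n * (\<Sum>m\<in>S. of_rat (Poly_Mapping.lookup f m) * L m N $ k) =
      (\<Sum>ks\<in>compositions n k. g ks * (\<Sum>ms\<in>{ms\<in>tuples (odds N) n. sorted_wrt R ms}. inverse_monomial ks ms))" for N
    proof -
      define H where "H ms = (\<Sum>ks\<in>compositions n k. g ks * inverse_monomial ks ms)" for ms
      have "(\<Sum>m\<in>S. of_rat (Poly_Mapping.lookup f m) * L m N $ k) =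
        (\<Sum>m\<in>S. \<Sum>ms\<in>tuples (odds N) n. tuple_weight (of_rat e) ms * (\<Sum>ks\<in>compositions n k.
            of_rat (Poly_Mapping.lookup f m) * (\<Prod>i<n. real (ks ! i) ^ (ex m ! i)) * inverse_monomial ks ms))"
        unfolding L_def by (subst tuple_sum_pow_nth[of _ n]) (simp_all add: ex_def sum_distrib_left mult_ac)
      also have "\<dots> = (\<Sum>ms\<in>tuples (odds N) n. \<Sum>m\<in>S. tuple_weight (of_rat e) ms * (\<Sum>ks\<in>compositions n k.
            of_rat (Poly_Mapping.lookup f m) * (\<Prod>i<n. real (ks ! i) ^ (ex m ! i)) * inverse_monomial ks ms))"
        by (rule sum.swap)
      also have "\<dots> = (\<Sum>ms\<in>tuples (odds N) n. tuple_weight (of_rat e) ms * (\<Sum>m\<in>S. \<Sum>ks\<in>compositions n k.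
            of_rat (Poly_Mapping.lookup f m) * (\<Prod>i<n. real (ks ! i) ^ (ex m ! i)) * inverse_monomial ks ms))"
        by (simp only: sum_distrib_left)
      also have "\<dots> = (\<Sum>ms\<in>tuples (odds N) n. tuple_weight (of_rat e) ms * H ms)"
        unfolding H_def g_eq sum_distrib_right
        by (intro sum.cong refl arg_cong2[of _ _ _ _ "(*)"] sum.swap)
      also have "\<dots> = fact n * (\<Sum>ms\<in>{ms\<in>tuples (odds N) n. sorted_wrt R ms}. H ms)"
        by (rule averaging) (simp_all only: finite_odds H_def symmetric_sum_mset_invariant[of n k g, OF g_perm])
      also have "(\<Sum>ms\<in>{ms\<in>tuples (odds N) n. sorted_wrt R ms}. H ms) =
         (\<Sum>ks\<in>compositions n k. g ks * (\<Sum>ms\<in>{ms\<in>tuples (odds N) n. sorted_wrt R ms}. inverse_monomial ks ms))"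
        unfolding H_def sum_distrib_left by (rule sum.swap)
      finally show ?thesis by simp
    qed
    hence lim2: "(\<lambda>N. 1 / fact n * (\<Sum>m\<in>S. of_rat (Poly_Mapping.lookup f m) * L m N $ k)) \<longlonglongrightarrow>
        (\<Sum>ks\<in>compositions n k. g ks * tv ks)"
      by (simp only:) (intro tendsto_intros tv)
    from LIMSEQ_unique[OF lim1 lim2] show ?thesis .
  qed
  show ?thesis using FC Fk unfolding g_def by blast
qed

text \<open>
  Replaces \<open>p\<^sup>l\<close> by a rational multiple of \<open>\<zeta>(2l)\<close>, absorbed in the coefficient polynomial, and checks that the bounds on \<open>l\<close>
  from the weight and from the number of factors are those given by \<open>T\<close>.
\<close>

lemma power_span_zeta_form:
  fixes n r T :: nat
  assumes F: "F \<in> rat_span (power_basis n (r + n))" and n: "n \<ge> 1"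
    and T: "int T = max \<lfloor>(real r + real n - 2) / 2\<rfloor> \<lfloor>(real n - 1) / 2\<rfloor>"
  shows "\<exists>c :: nat \<Rightarrow> rat poly. (\<forall>l\<le>T. degree_le (c l) (int r + int n - 2 * int l - 1)) \<and>
     (\<forall>k\<ge>n. F $ k = (\<Sum>l = 0..min T k. of_rat (poly (c l) (of_nat k)) * zeta (2 * l) * tval (2 * k - 2 * l)))"
proof -
  have "F \<in> t_form (r + n) (max (r + n - 1) n) n" using power_basis_t_form[OF F n] by simp
  then obtain c :: "nat \<Rightarrow> rat poly"
    where c: "\<And>l. c l \<noteq> 0 \<Longrightarrow> degree (c l) + 2 * l + 1 \<le> r + n \<and> 2 * l + 1 \<le> max (r + n - 1) n"
      and Fk: "\<And>k. k \<ge> n \<Longrightarrow> F $ k = (\<Sum>l\<le>k. of_rat (poly (c l) (of_nat k)) * (t_even 1 ^ l * t_even (k - l)))"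
    by (rule t_formE) blast
  obtain \<rho> :: "nat \<Rightarrow> rat" where \<rho>: "\<And>l. t_even 1 ^ l = of_rat (\<rho> l) * zeta (2 * l)"
    using t_even_power_eq_rat_zeta by metis
  have cT: "l \<le> T" if "c l \<noteq> 0" for l
  proof -
    \<comment> \<open>Terms from the ideal satisfy the first inequality, the term from an odd power of \<open>tG\<close> the second.\<close>
    have "2 * l + 2 \<le> r + n \<or> 2 * l + 1 \<le> n" using c[OF that] by linarith
    then consider "2 * l + 2 \<le> r + n" | "2 * l + 1 \<le> n" by blast
    hence "int l \<le> int T"
    proof cases
      case 1
      hence "real (2 * l + 2) \<le> real (r + n)" by (simp only: of_nat_le_iff)
      hence "int l \<le> \<lfloor>(real r + real n - 2) / 2\<rfloor>" by (simp add: le_floor_iff)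
      thus ?thesis using T by simp
    next
      case 2
      hence "real (2 * l + 1) \<le> real n" by (simp only: of_nat_le_iff)
      hence "int l \<le> \<lfloor>(real n - 1) / 2\<rfloor>" by (simp add: le_floor_iff)
      thus ?thesis using T by simp
    qed
    thus ?thesis by simp
  qed
  show ?thesis
  proof (intro exI[of _ "\<lambda>l. smult (\<rho> l) (c l)"] conjI allI impI)
    fix l
    show "degree_le (smult (\<rho> l) (c l)) (int r + int n - 2 * int l - 1)"
    proof (cases "smult (\<rho> l) (c l) = 0")
      case False
      hence "\<rho> l \<noteq> 0" "c l \<noteq> 0" by auto
      thus ?thesis using c[of l] by (simp add: degree_le_def)
    qed (simp add: degree_le_def)
  next
    fix k assume "k \<ge> n"
    hence "F $ k = (\<Sum>l\<le>k. of_rat (poly (c l) (of_nat k)) * (t_even 1 ^ l * t_even (k - l)))" by (rule Fk)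
    also have "\<dots> = (\<Sum>l=0..min T k. of_rat (poly (c l) (of_nat k)) * (t_even 1 ^ l * t_even (k - l)))"
    proof (rule sum.mono_neutral_right)
      show "\<forall>l\<in>{..k} - {0..min T k}. of_rat (poly (c l) (of_nat k)) * (t_even 1 ^ l * t_even (k - l)) = 0"
      proof
        fix l assume "l \<in> {..k} - {0..min T k}"
        hence "c l = 0" using cT[of l] by (cases "c l = 0") auto
        thus "of_rat (poly (c l) (of_nat k)) * (t_even 1 ^ l * t_even (k - l)) = 0" by simp
      qed
    qed auto
    also have "\<dots> = (\<Sum>l = 0..min T k. of_rat (poly (smult (\<rho> l) (c l)) (of_nat k)) * zeta (2 * l) * tval (2 * k - 2 * l))"
    proof (intro sum.cong refl)
      fix l
      have "2 * k - 2 * l = 2 * (k - l)" by simp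
      hence "tval (2 * k - 2 * l) = t_even (k - l)" by (simp only: tval_eq_t_even)
      thus "of_rat (poly (c l) (of_nat k)) * (t_even 1 ^ l * t_even (k - l)) =
          of_rat (poly (smult (\<rho> l) (c l)) (of_nat k)) * zeta (2 * l) * tval (2 * k - 2 * l)"
        by (simp only: poly_smult of_rat_mult \<rho>[of l] mult_ac)
    qed
    finally show "F $ k = \<dots>" .
  qed
qed

theorem theorem1p1:
  fixes n r T :: nat and f :: "rat mpoly"
  assumes "n \<ge> 1"
    and "mpoly_vars f \<subseteq> {..<n}"
    and "symmetric_mpoly n f"
    and "mpoly_degree f = r"
    and "int T = max \<lfloor>(real r + real n - 2) / 2\<rfloor> \<lfloor>(real n - 1) / 2\<rfloor>"
  shows "\<exists>c c_star :: nat \<Rightarrow> rat poly.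
    (\<forall>l\<le>T. degree_le (c l) (int r + int n - 2 * int l - 1) \<and>
            degree_le (c_star l) (int r + int n - 2 * int l - 1)) \<and>
    (\<forall>k\<ge>n.
      (\<Sum>ks \<in> compositions n k.
          of_rat (mpoly_eval (\<lambda>i. of_nat (ks ! i)) f) * mtv (map (\<lambda>j. 2 * j) ks)) =
      (\<Sum>l = 0..min T k. of_rat (poly (c l) (of_nat k)) * zeta (2 * l) * tval (2 * k - 2 * l)) \<and>
      (\<Sum>ks \<in> compositions n k.
          of_rat (mpoly_eval (\<lambda>i. of_nat (ks ! i)) f) * mtv_star (map (\<lambda>j. 2 * j) ks)) =
      (\<Sum>l = 0..min T k. of_rat (poly (c_star l) (of_nat k)) * zeta (2 * l) * tval (2 * k - 2 * l)))"
proof -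
  have comp: "(\<lambda>N. \<Sum>ms\<in>{ms\<in>tuples (odds N) n. sorted_wrt R ms}. inverse_monomial ks ms) \<longlonglongrightarrow>
      infsum (inverse_monomial ks) {ms. length ms = length ks \<and> sorted_wrt R ms \<and> (\<forall>m\<in>set ms. odd m)}"
    if "ks \<in> compositions n k" for ks k R
    using sum_inverse_monomial_LIMSEQ[of ks R] that by (auto simp: compositions_def)
  obtain F where F: "F \<in> rat_span (power_basis n (r + n))" "\<And>k. F $ k =
      (\<Sum>ks\<in>compositions n k. of_rat (mpoly_eval (\<lambda>i. of_nat (ks ! i)) f) * mtv (map (\<lambda>j. 2 * j) ks))"
    using weighted_sum_in_power_span[OF assms(2,3), where e = "- 1" and R = "(>)" and tv = "\<lambda>ks. mtv (map (\<lambda>j. 2 * j) ks)"]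
      sum_strictly_decreasing comp
    unfolding assms(4) mtv_eq_infsum of_rat_minus of_rat_1 by blast
  obtain F' where F': "F' \<in> rat_span (power_basis n (r + n))" "\<And>k. F' $ k =
      (\<Sum>ks\<in>compositions n k. of_rat (mpoly_eval (\<lambda>i. of_nat (ks ! i)) f) * mtv_star (map (\<lambda>j. 2 * j) ks))"
    using weighted_sum_in_power_span[OF assms(2,3), where e = 1 and R = "(\<ge>)" and tv = "\<lambda>ks. mtv_star (map (\<lambda>j. 2 * j) ks)"]
      sum_weakly_decreasing comp
    unfolding assms(4) mtv_star_eq_infsum of_rat_1 by blast
  show ?thesis
    using power_span_zeta_form[OF F(1) assms(1,5)] power_span_zeta_form[OF F'(1) assms(1,5)]
    unfolding F(2) F'(2) by blast
qed

end
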